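(* Assume the genericity condition $\overline\sigma_{n-p}:=\sigma_{n-p}(AQ_2)>\widetilde\sigma_{n-p+1}:=\sigma_{n-p+1}([AQ_2\ \ \zeta r_{C}])$ holds, let $x=\phi([L\ \ h])$ be the unique TLSE solution, and let $\alpha,\beta>0$. Put $\rho=\sqrt{1+\|x\|_2^2}$, $r=Ax-b$, $t^T=\big[-r^T(\widetilde A\widetilde C^\dagger)\ \ \ r^T\big]$, and $H_1=2\rho^{-2}\mathcal K x t^T-[C_A^\dagger\ \ \ \mathcal K A^T]$, and assume $x\neq0$ and $t\ne 0$. Then the normwise condition number $\kappa_{\rm n}$ of the TLSE problem satisfies $$\kappa_{\rm n}=\left\|\Big[-\frac{\|x\|_2}{\beta}H_1\ \ \ \frac{\|t\|_2}{\alpha}\mathcal K\Big]\begin{bmatrix}c_1I_m-c_2\dfrac{tt^T}{\|t\|_2^2}&\dfrac{\beta}{\alpha}\dfrac{tx^T}{\|t\|_2\|x\|_2}\\0&I_n\end{bmatrix}\right\|_2\cdot\frac{\|[L\ \ h]\|_{\mathcal F}}{\|x\|_2},$$ where $c_1=\pm\sqrt{\frac{\beta^2}{\alpha^2}+\frac1{\|x\|_2^2}}$ and $c_2=c_1\pm\frac1{\|x\|_2}$ (for any choice of the signs). Moreover $\kappa_{\rm n}\le\kappa_{\rm n}^{\rm U}$, where $$\kappa_{\rm n}^{\rm U}=\Big[\frac{\|x\|_2}{\beta}\|H_1\|_2+\frac{\|t\|_2}{\alpha}\|\mathcal K\|_2\Big]\frac{\|[L\ \ h]\|_{\mathcal F}}{\|x\|_2}\sqrt{\max\Big\{1,\frac{\beta^2}{\alpha^2}+\frac1{\|x\|_2^2}\Big\}+\frac\beta\alpha},$$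 and $$\kappa_{\rm n}^{\rm U}\le\Big[\frac{\|x\|_2}{\beta}\big(\|C_A^\dagger\|_2+\|\mathcal KA^T\|_2\big)+\Big(\frac2\beta+\frac1\alpha\Big)\|\mathcal K\|_2\|t\|_2\Big]\frac{\|[L\ \ h]\|_{\mathcal F}}{\|x\|_2}\sqrt{\max\Big\{1,\frac{\beta^2}{\alpha^2}+\frac1{\|x\|_2^2}\Big\}+\frac\beta\alpha}.$$
   Context: TLSE problem (total least squares with linear equality constraint): given $A\in\mathbb R^{q\times n}$ ($q>n$), $b\in\mathbb R^q$, $C\in\mathbb R^{p\times n}$, $d\in\mathbb R^p$, where $C$ has full row rank $p$ and $\begin{bmatrix}C\\ A\end{bmatrix}$ has full column rank $n$, solve $$\min_{E,f}\|[E\ \ f]\|_F\quad\text{subject to}\quad (A+E)x=b+f,\ \ Cx=d.$$ Notation: $\|\cdot\|_F$ is the Frobenius norm, $\|\cdot\|_2$ the Euclidean vector norm or spectral matrix norm, $\sigma_j(M)$ the $j$-th largest singular value of $M$, $M^\dagger$ the Moore–Penrose inverse. $\widetilde A=[A\ \ b]$, $\widetilde C=[C\ \ d]$, $L=\begin{bmatrix}C\\ A\end{bmatrix}\in\mathbb R^{m\times n}$, $h=\begin{bmatrix}d\\ b\end{bmatrix}\in\mathbb R^{m}$, $m=p+q$. Let $C^T=[Q_1\ \ Q_2]\begin{bmatrix}R_1\\0\end{bmatrix}=Q_1R_1$ be a QR factorization ($[Q_1\ \ Q_2]$ orthogonal, $Q_1\in\mathbb R^{n\times p}$, $R_1\in\mathbb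 R^{p\times p}$), $x_{C}=C^\dagger d$, $r_{C}=Ax_{C}-b$, $\zeta=(1+\|x_{C}\|_2^2)^{-1/2}$. Under the genericity condition in the claim, the TLSE problem has a unique solution, namely $$x=C^\dagger d-Q_2S_{11}^{-1}Q_2^TA^Tr_{C}=C_A^\dagger d+\mathcal K A^Tb,$$ where $S_{11}=Q_2^TA^TAQ_2-\widetilde\sigma_{n-p+1}^2I_{n-p}$, $\mathcal K=Q_2S_{11}^{-1}Q_2^T$, and $C_A^\dagger=(I_n-\mathcal KA^TA)C^\dagger$. The map $\phi$ sends input data $[L\ \ h]\in\mathbb R^{m\times n}\times\mathbb R^m$ to the corresponding TLSE solution $x$ (it is defined on a neighborhood of the given data, since sufficiently small perturbations also give a uniquely solvable TLSE problem). For $\alpha,\beta>0$ the flexible norm on $\mathbb R^{m\times n}\times\mathbb R^m$ is $\|[E\ \ f]\|_{\mathcal F}=\sqrt{\alpha^2\|E\|_F^2+\beta^2\|f\|_2^2}$. The normwise condition number is $$\kappa_{\rm n}=\lim_{\eta\to0}\sup\Big\{\frac{\|\Delta x\|_2}{\eta\|x\|_2}:\ \|[\Delta L\ \ \Delta h]\|_{\mathcal F}\le\eta\|[L\ \ h]\|_{\mathcal F}\Big\},\qquad \Delta x=\phi([L\ \ h]+[\Delta L\ \ \Delta h])-\phi([L\ \ h]).$$ *)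

theory Defs
  imports "HOL-Analysis.Analysis" "HOL-Computational_Algebra.Polynomial"
begin

text \<open>
  Matrices with \<open>m\<close> rows and \<open>n\<close> columns have type \<^typ>\<open>real^'n^'m\<close>; block matrices are indexed
  by sum types. On \<^typ>\<open>real^'n^'m\<close>, \<^const>\<open>norm\<close> is the Frobenius norm (the Euclidean norm of the
  vector of Euclidean norms of the rows). The spectral norm is \<open>spec_norm\<close> below.
\<close>

definition spec_norm :: "real^'n^'m \<Rightarrow> real" where
  "spec_norm M = onorm (\<lambda>v. M *v v)"

definition hcat :: "'a^'n^'m \<Rightarrow> 'a^'k^'m \<Rightarrow> 'a^('n::finite + 'k::finite)^'m" where
  "hcat M N = (\<chi> i j. case j of Inl a \<Rightarrow> M $ i $ a | Inr b \<Rightarrow> N $ i $ b)"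

text \<open>Stacking is polymorphic in the entries: it stacks vectors, and also matrices (vectors of rows).\<close>

definition vcat :: "'a^'m \<Rightarrow> 'a^'k \<Rightarrow> 'a^('m::finite + 'k::finite)" where
  "vcat u v = (\<chi> i. case i of Inl a \<Rightarrow> u $ a | Inr b \<Rightarrow> v $ b)"

definition top_part :: "'a^('m::finite + 'k::finite) \<Rightarrow> 'a^'m" where
  "top_part u = (\<chi> i. u $ Inl i)"

definition bottom_part :: "'a^('m::finite + 'k::finite) \<Rightarrow> 'a^'k" where
  "bottom_part u = (\<chi> i. u $ Inr i)"

definition append_col :: "'a^'n^'m \<Rightarrow> 'a^'m \<Rightarrow> 'a^('n::finite + 1)^'m" where
  "append_col M v = hcat M (columnvector v)"

definition outer :: "real^'m \<Rightarrow> real^'n \<Rightarrow> real^'n^'m" where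
  "outer u v = (columnvector u :: real^1^'m) ** rowvector v"

definition char_poly_mat :: "real^'n^'n \<Rightarrow> real poly" where
  "char_poly_mat N = det (\<chi> i j. (if i = j then [:0, 1:] else 0) - [:N $ i $ j:])"

text \<open>
  The singular values of \<open>M\<close> are the square roots of the eigenvalues of \<open>M\<^sup>T M\<close>, counted with
  multiplicity. For \<open>M\<close> with \<open>n\<close> columns this yields \<open>n\<close> of them (padded with zeros if there are
  fewer than \<open>n\<close> rows); \<open>j\<close> counts from 1.
\<close>

definition singular_values :: "real^'n^'m \<Rightarrow> real multiset" where
  "singular_values M = image_mset sqrt (proots (char_poly_mat (transpose M ** M)))"

definition sing_val :: "nat \<Rightarrow> real^'n^'m \<Rightarrow> real" where
  "sing_val j M = rev (sorted_list_of_multiset (singular_values M)) ! (j - 1)"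

definition is_pinv :: "real^'n^'m \<Rightarrow> real^'m^'n \<Rightarrow> bool" where
  "is_pinv M X \<longleftrightarrow> M ** X ** M = M \<and> X ** M ** X = X \<and>
     transpose (M ** X) = M ** X \<and> transpose (X ** M) = X ** M"

definition pinv :: "real^'n^'m \<Rightarrow> real^'m^'n" where
  "pinv M = (THE X. is_pinv M X)"

text \<open>
  Full QR factorization \<open>M = [Q\<^sub>1 Q\<^sub>2] [R\<^sub>1; 0]\<close>. The index types of the rows and the columns of
  \<open>[Q\<^sub>1 Q\<^sub>2]\<close> differ, so its orthogonality is stated as in \<^const>\<open>orthogonal_matrix\<close>, but with
  identity matrices on both index types.
\<close>

definition is_full_QR ::
    "real^'p::{finite,linorder}^'n \<Rightarrow> real^'p::{finite,linorder}^'n \<Rightarrow> real^'r^'n \<Rightarrow>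
      real^'p::{finite,linorder}^'p::{finite,linorder} \<Rightarrow> bool" where
  "is_full_QR M Q1 Q2 R1 \<longleftrightarrow>
     transpose (hcat Q1 Q2) ** hcat Q1 Q2 = mat 1 \<and>
     hcat Q1 Q2 ** transpose (hcat Q1 Q2) = mat 1 \<and>
     (\<forall>i j. j < i \<longrightarrow> R1 $ i $ j = 0) \<and>
     M = hcat Q1 Q2 ** vcat R1 (0 :: real^'p::{finite,linorder}^'r)"

definition tlse_feasible ::
    "real^'n^'q \<Rightarrow> real^'q \<Rightarrow> real^'n^'p \<Rightarrow> real^'p \<Rightarrow> real^'n^'q \<Rightarrow> real^'q \<Rightarrow> real^'n \<Rightarrow> bool" where
  "tlse_feasible A b C d E f x \<longleftrightarrow> (A + E) *v x = b + f \<and> C *v x = d"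

definition is_tlse_solution ::
    "real^'n^'q \<Rightarrow> real^'q \<Rightarrow> real^'n^'p \<Rightarrow> real^'p \<Rightarrow> real^'n \<Rightarrow> bool" where
  "is_tlse_solution A b C d x \<longleftrightarrow>
     (\<exists>E f. tlse_feasible A b C d E f x \<and>
        (\<forall>E' f' x'. tlse_feasible A b C d E' f' x' \<longrightarrow>
           norm (append_col E f) \<le> norm (append_col E' f')))"

text \<open>
  The map \<open>\<phi>\<close> from \<open>L = [C; A]\<close>, \<open>h = [d; b]\<close> to the solution; it is meaningful only where the
  solution is unique, as it is on a neighbourhood of generic data.
\<close>

definition tlse_map :: "real^'n^('p::finite + 'q::finite) \<Rightarrow> real^('p + 'q) \<Rightarrow> real^'n" where
  "tlse_map L h =
     (THE x. is_tlse_solution (bottom_part L) (bottom_part h) (top_part L) (top_part h) x)"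

definition flex_norm :: "real \<Rightarrow> real \<Rightarrow> real^'n^'m \<Rightarrow> real^'m \<Rightarrow> real" where
  "flex_norm \<alpha> \<beta> E f = sqrt (\<alpha>\<^sup>2 * (norm E)\<^sup>2 + \<beta>\<^sup>2 * (norm f)\<^sup>2)"

text \<open>
  The supremum is taken in the extended reals, so that an unbounded set has supremum \<open>\<infinity>\<close>.
\<close>

definition cond_quotient_sup ::
    "(real^'n^'m \<Rightarrow> real^'m \<Rightarrow> real^'k) \<Rightarrow> real \<Rightarrow> real \<Rightarrow> real^'n^'m \<Rightarrow> real^'m \<Rightarrow> real \<Rightarrow> ereal" where
  "cond_quotient_sup \<phi> \<alpha> \<beta> L h \<eta> =
     Sup {ereal (norm (\<phi> (L + \<Delta>L) (h + \<Delta>h) - \<phi> L h) / (\<eta> * norm (\<phi> L h))) | \<Delta>L \<Delta>h.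
            flex_norm \<alpha> \<beta> \<Delta>L \<Delta>h \<le> \<eta> * flex_norm \<alpha> \<beta> L h}"

definition normwise_cond ::
    "(real^'n^'m \<Rightarrow> real^'m \<Rightarrow> real^'k) \<Rightarrow> real \<Rightarrow> real \<Rightarrow> real^'n^'m \<Rightarrow> real^'m \<Rightarrow> ereal" where
  "normwise_cond \<phi> \<alpha> \<beta> L h = Lim (at_right 0) (cond_quotient_sup \<phi> \<alpha> \<beta> L h)"

end

theory Submission
  imports Defs
begin

text \<open>
  \<^bold>\<open>Why the formula holds.\<close> For fixed \<open>x\<close> with \<open>C x = d\<close> the smallest correction \<open>[E f]\<close> has squared
  Frobenius norm \<open>|A x - b|\<^sup>2 / (1 + |x|\<^sup>2)\<close>, so the TLSE problem minimises this quotient over an affine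
  space. Writing \<open>z = (u, \<tau>)\<close> and \<open>G z = L u - \<tau> h\<close>, it becomes the minimisation of the Rayleigh quotient
  \<open>|G z|\<^sup>2 / |z|\<^sup>2\<close> over the linear space on which the top block of \<open>G z\<close> vanishes, and \<open>x\<close> is recovered
  from a minimiser as \<open>u / \<tau>\<close>. In the orthonormal coordinates given by \<open>Q\<^sub>2\<close> and \<open>\<zeta>\<close> this is the smallest
  singular value of \<open>[A Q\<^sub>2  \<zeta> r\<^sub>C]\<close>; the genericity condition rules out minimisers with
  \<open>\<tau> = 0\<close>. Minimisers for one value form a linear space, so this also makes \<open>x\<close> unique
  (\<open>tlse_map_eq_hom_minimiser\<close>, \<open>reduced_tls_matrix\<close>). Limits of minimisers are minimisers, so both
  properties persist, and the solution varies continuously, under small changes of the data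
  (\<open>tlse_map_stable\<close>).

  A minimiser has a Lagrange multiplier: a vector \<open>t\<close> with \<open>L\<^sup>T t = s x\<close> and \<open>h\<^sup>T t = - s\<close>, where \<open>s\<close> is the
  minimal value. The top block of \<open>t\<close> is minus the multiplier of the constraint, its bottom block is the
  residual, and \<open>t\<close> is the vector of the theorem. Subtracting the multiplier equations of two data
  sets gives an identity for \<open>x' - x\<close>, without any remainder term, in which the perturbation
  occurs linearly and all other quantities converge
  (\<open>tlse_exact_difference\<close>). Hence the solution map is differentiable with derivative
  \<open>T (\<Delta>L, \<Delta>h) = H\<^sub>1 (\<Delta>L x - \<Delta>h) - K \<Delta>L\<^sup>T t\<close> (\<open>tlse_map_has_derivative\<close>).

  The limit of the suprema is the operator norm of the derivative with respect to the flexible norm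
  (\<open>cond_quotient_sup_tendsto\<close>). The operator norm is computed on the adjoint: the matrix \<open>M\<close> in the
  theorem is built so that \<open>|M\<^sup>T v|\<close> equals the norm of the adjoint of \<open>T\<close> at \<open>v\<close>, for every choice of
  signs (\<open>condition_matrix_adjoint_norm\<close>, \<open>derivative_flex_norm\<close>). The first upper bound follows
  from the same expression for \<open>|M\<^sup>T v|\<^sup>2\<close> by the Cauchy--Schwarz inequality, the second from the triangle
  inequality for \<open>H\<^sub>1\<close> and \<open>|x| \<le> \<rho>\<close>.
\<close>

section \<open>Quadratic forms on a subspace\<close>

lemma quadratic_nonneg_imp_linear_coeff_0:
  fixes a b :: real
  assumes "\<And>e. 0 \<le> e * a + e\<^sup>2 * b"
  shows "a = 0"
proof (rule ccontr)
  assume a: "a \<noteq> 0"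
  define c where "c = 1 + \<bar>b\<bar>"
  \<comment> \<open>any small \<open>e\<close> of sign opposite to \<open>a\<close> works; this one gives the upper bound \<open>- a\<^sup>2 / c\<^sup>2\<close>\<close>
  define e where "e = - a / c"
  have pos: "c > 0" "\<bar>b\<bar> = c - 1" by (simp_all add: c_def)
  have "e * a + e\<^sup>2 * b \<le> e * a + e\<^sup>2 * \<bar>b\<bar>" by (simp add: mult_left_mono)
  also have "\<dots> = - (a\<^sup>2 / c\<^sup>2)"
    using pos(1) unfolding pos(2) by (simp add: e_def field_simps power2_eq_square)
  also have "\<dots> < 0" using a pos by simp
  finally show False using assms[of e] by linarith
qed

lemma norm_add_scaleR_sq:
  fixes u v :: "'a::real_inner"
  shows "(norm (u + e *\<^sub>R v))\<^sup>2 = (norm u)\<^sup>2 + 2 * e * (u \<bullet> v) + e\<^sup>2 * (norm v)\<^sup>2"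
  by (simp add: power2_norm_eq_inner inner_add inner_commute[of v u])
    (simp add: power2_eq_square algebra_simps)

text \<open>
  First-order condition at a minimiser of \<open>|G w|\<^sup>2 / |w|\<^sup>2\<close>: on the line \<open>z + e w\<close> the nonnegative function
  \<open>|G (\<cdot>)|\<^sup>2 - s |\<cdot>|\<^sup>2\<close> has value \<open>0\<close> at \<open>e = 0\<close>, so its linear coefficient vanishes. The lemma is used for
  the singular vectors, for the linearity of the set of minimisers and for the Lagrange multiplier.
\<close>

lemma rayleigh_minimiser_stationary:
  fixes G :: "'a::real_inner \<Rightarrow> 'b::real_inner"
  assumes G: "linear G" and V: "subspace V"
    and min: "\<And>w. w \<in> V \<Longrightarrow> s * (norm w)\<^sup>2 \<le> (norm (G w))\<^sup>2"
    and z: "z \<in> V" "(norm (G z))\<^sup>2 = s * (norm z)\<^sup>2" and w: "w \<in> V"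
  shows "G z \<bullet> G w = s * (z \<bullet> w)"
proof -
  have "0 \<le> e * (2 * (G z \<bullet> G w - s * (z \<bullet> w))) + e\<^sup>2 * ((norm (G w))\<^sup>2 - s * (norm w)\<^sup>2)" for e
  proof -
    have "z + e *\<^sub>R w \<in> V" using V z(1) w by (simp add: subspace_add subspace_scale)
    from min[OF this] have "s * (norm (z + e *\<^sub>R w))\<^sup>2 \<le> (norm (G z + e *\<^sub>R G w))\<^sup>2"
      by (simp add: linear_add[OF G] linear_scale[OF G])
    then show ?thesis using z(2)
      unfolding norm_add_scaleR_sq by (simp add: algebra_simps)
  qed
  from quadratic_nonneg_imp_linear_coeff_0[OF this] show ?thesis by simp
qed

lemma rayleigh_minimiser_exists:
  fixes G :: "'a::euclidean_space \<Rightarrow> 'b::euclidean_space"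
  assumes G: "linear G" and V: "subspace V" and "V \<noteq> {0}"
  obtains z where "z \<in> V" "norm z = 1"
    "\<And>w. w \<in> V \<Longrightarrow> (norm (G z))\<^sup>2 * (norm w)\<^sup>2 \<le> (norm (G w))\<^sup>2"
proof -
  let ?S = "V \<inter> sphere 0 1"
  obtain v where v: "v \<in> V" "v \<noteq> 0" using assms(3) subspace_0[OF V] by blast
  then have "v /\<^sub>R norm v \<in> ?S" using V by (auto simp: subspace_scale)
  moreover have "compact ?S" using V by (simp add: closed_subspace closed_Int_compact)
  moreover have "continuous_on ?S (\<lambda>v. norm (G v))"
    using G by (intro continuous_on_norm linear_continuous_on) (simp add: linear_conv_bounded_linear)
  ultimately obtain z where z: "z \<in> ?S" "\<And>w. w \<in> ?S \<Longrightarrow> norm (G z) \<le> norm (G w)"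
    by (metis continuous_attains_inf emptyE)
  have "norm (G z) * norm w \<le> norm (G w)" if w: "w \<in> V" for w
  proof (cases "w = 0")
    case False
    then have "w /\<^sub>R norm w \<in> ?S" using V w by (auto simp: subspace_scale)
    from z(2)[OF this] show ?thesis using False by (simp add: linear_scale[OF G] field_simps)
  qed (simp add: linear_0[OF G])
  then have "(norm (G z))\<^sup>2 * (norm w)\<^sup>2 \<le> (norm (G w))\<^sup>2" if "w \<in> V" for w
    using power_mono[OF _ mult_nonneg_nonneg[OF norm_ge_zero norm_ge_zero], of "G z" w "norm (G w)" 2] that
    by (simp add: power_mult_distrib)
  then show ?thesis using that z(1) by auto
qed

text \<open>
  Split off a minimiser \<open>z\<close> of \<open>|G w|\<^sup>2 / |w|\<^sup>2\<close>. By stationarity, vectors orthogonal to \<open>z\<close> are mapped to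
  vectors orthogonal to \<open>G z\<close>, so the induction hypothesis applies to the orthogonal complement of \<open>z\<close>.
\<close>

lemma right_singular_basis:
  fixes G :: "'a::euclidean_space \<Rightarrow> 'b::euclidean_space"
  assumes G: "linear G" and V: "subspace V"
  obtains B where "B \<subseteq> V" "pairwise orthogonal B" "\<And>v. v \<in> B \<Longrightarrow> norm v = 1"
    "pairwise (\<lambda>v w. orthogonal (G v) (G w)) B" "card B = dim V" "finite B"
proof -
  have "\<exists>B\<subseteq>V. pairwise orthogonal B \<and> (\<forall>v\<in>B. norm v = 1) \<and>
      pairwise (\<lambda>v w. orthogonal (G v) (G w)) B \<and> card B = dim V \<and> finite B" using V
  proof (induction "dim V" arbitrary: V)
    case 0
    then show ?case by (intro exI[of _ "{}"]) simp
  next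
    case (Suc k)
    then have "V \<noteq> {0}" by auto
    from rayleigh_minimiser_exists[OF G Suc.prems this] obtain z where z: "z \<in> V" "norm z = 1"
      and min: "\<And>w. w \<in> V \<Longrightarrow> (norm (G z))\<^sup>2 * (norm w)\<^sup>2 \<le> (norm (G w))\<^sup>2" by blast
    define W where "W = {y \<in> V. orthogonal z y}"
    have W: "subspace W" using Suc.prems unfolding W_def
      by (auto simp: subspace_def orthogonal_def inner_add_right)
    have "dim {y \<in> V. \<forall>x\<in>span {z}. orthogonal x y} + dim (span {z}) = dim V"
      using dim_subspace_orthogonal_to_vectors[OF subspace_span[of "{z}"] Suc.prems] z(1)
        Suc.prems by (metis (no_types, lifting) empty_subsetI insert_subset span_minimal)
    moreover have "{y \<in> V. \<forall>x\<in>span {z}. orthogonal x y} = W"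
      by (auto simp: W_def span_singleton orthogonal_def dest: spec[of _ 1])
    moreover have "dim (span {z}) = 1" using z(2) by (auto simp: dim_insert)
    ultimately have dW: "k = dim W" using Suc.hyps(2) by simp
    from Suc.hyps(1)[OF dW W] obtain B where B: "B \<subseteq> W" "pairwise orthogonal B"
      "\<forall>v\<in>B. norm v = 1" "pairwise (\<lambda>v w. orthogonal (G v) (G w)) B" "card B = dim W" "finite B"
      by blast
    have zB: "z \<notin> B" using B(1) z(2) by (auto simp: W_def orthogonal_def)
    have "orthogonal (G z) (G v)" if "v \<in> B" for v
    proof -
      have v: "v \<in> V" "orthogonal z v" using that B(1) by (auto simp: W_def)
      have "G z \<bullet> G v = (norm (G z))\<^sup>2 * (z \<bullet> v)"
        using min z v by (intro rayleigh_minimiser_stationary[OF G Suc.prems]) auto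
      then show ?thesis using v(2) by (simp add: orthogonal_def)
    qed
    moreover have "v \<in> V \<and> orthogonal z v" if "v \<in> B" for v
      using that B(1) by (auto simp: W_def)
    ultimately show ?case using B(2-) z zB dW Suc.hyps(2)
      by (intro exI[of _ "insert z B"]) (auto simp: pairwise_insert orthogonal_commute)
  qed
  then show thesis using that by blast
qed

section \<open>Singular values\<close>

text \<open>
  Determinants of matrices over any commutative ring are multiplicative, so \<open>X I - N\<close> can be conjugated
  by \<open>Q\<close> with its entries read as constant polynomials.
\<close>

lemma char_poly_of_diagonalised:
  fixes N Q :: "real^'n^'n"
  assumes Q: "orthogonal_matrix Q"
    and diag: "\<And>i j. i \<noteq> j \<Longrightarrow> (transpose Q ** N ** Q) $ i $ j = 0"
  shows "char_poly_mat N = (\<Prod>i\<in>UNIV. [:- (transpose Q ** N ** Q) $ i $ i, 1:])"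
proof -
  \<comment> \<open>entrywise embedding into matrices over the polynomial ring\<close>
  define const :: "real^'n^'n \<Rightarrow> real poly^'n^'n" where "const M = (\<chi> i j. [:M $ i $ j:])" for M
  have const_sum: "[:sum f S:] = (\<Sum>k\<in>S. [:f k:])" for f :: "'n \<Rightarrow> real" and S
  proof (induction S rule: infinite_finite_induct)
    case (insert x S)
    then show ?case by (simp flip: insert.IH)
  qed auto
  have const_mul: "const (M ** M') = const M ** const M'" for M M'
    by (simp add: const_def matrix_matrix_mult_def vec_eq_iff const_sum mult.commute)
  have QQ: "transpose Q ** Q = mat 1" "Q ** transpose Q = mat 1"
    using Q by (auto simp: orthogonal_matrix_def)
  have const1: "const (mat 1) = mat 1"
    by (auto simp: const_def mat_def vec_eq_iff one_pCons)
  have X: "(\<chi> i j. (if i = j then [:0, 1:] else 0) - [:N $ i $ j:]) = mat [:0,1:] - const N"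
    by (auto simp: const_def mat_def vec_eq_iff)
  have matX: "mat [:0,1:] ** M = (\<chi> i j. [:0,1:] * M $ i $ j)" for M :: "real poly^'n^'n"
    by (auto simp: matrix_matrix_mult_def mat_def vec_eq_iff if_distrib if_distribR sum.delta cong: if_cong)
  have Xmat: "M ** mat [:0,1:] = (\<chi> i j. M $ i $ j * [:0,1:])" for M :: "real poly^'n^'n"
    by (auto simp: matrix_matrix_mult_def mat_def vec_eq_iff if_distrib if_distribR sum.delta cong: if_cong)
  have "const (transpose Q) ** (mat [:0,1:] - const N) ** const Q
      = mat [:0,1:] ** (const (transpose Q) ** const Q) - const (transpose Q ** N ** Q)"
  proof -
    have "const (transpose Q) ** mat [:0,1:] = mat [:0,1:] ** const (transpose Q)"
      by (simp add: matX Xmat mult.commute)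
    moreover have "A ** (B - B') = A ** B - A ** B'" "(B - B') ** A = B ** A - B' ** A"
      for A B B' :: "real poly^'n^'n"
      by (simp_all add: matrix_matrix_mult_def vec_eq_iff algebra_simps sum_subtractf)
    ultimately show ?thesis by (simp add: const_mul matrix_mul_assoc)
  qed
  also have "\<dots> = mat [:0,1:] - const (transpose Q ** N ** Q)"
    by (simp add: const_mul[symmetric] QQ const1)
  finally have conj: "const (transpose Q) ** (mat [:0,1:] - const N) ** const Q
      = mat [:0,1:] - const (transpose Q ** N ** Q)" .
  have dQ: "det (const (transpose Q)) * det (const Q) = 1"
    by (metis QQ(1) const1 const_mul det_I det_mul)
  have "char_poly_mat N = det (mat [:0,1:] - const N)" by (simp add: char_poly_mat_def X)
  also have "\<dots> = det (const (transpose Q) ** (mat [:0,1:] - const N) ** const Q)"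
    using dQ by (simp add: det_mul mult.assoc mult.left_commute)
  also have "\<dots> = (\<Prod>i\<in>UNIV. (mat [:0,1:] - const (transpose Q ** N ** Q)) $ i $ i)"
    unfolding conj by (rule det_diagonal) (simp add: mat_def const_def diag)
  also have "\<dots> = (\<Prod>i\<in>UNIV. [:- (transpose Q ** N ** Q) $ i $ i, 1:])"
    by (simp add: mat_def const_def)
  finally show ?thesis .
qed

text \<open>
  The sorted list behind \<^const>\<open>sing_val\<close> can be indexed at the number \<open>n\<close> of columns only if the
  characteristic polynomial of \<open>M\<^sup>T M\<close> has \<open>n\<close> real roots. An orthonormal basis of right singular vectors
  shows this: the roots are the squares of the norms of their images. The last entry is then the smallest
  of these norms, and expanding \<open>v\<close> in the basis gives the variational characterisation.
\<close>

lemma smallest_sing_val: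
  fixes M :: "real^'n^'m"
  shows "sing_val CARD('n) M \<ge> 0"
    and "(sing_val CARD('n) M)\<^sup>2 * (norm v)\<^sup>2 \<le> (norm (M *v v))\<^sup>2"
    and "\<exists>v. v \<noteq> 0 \<and> (norm (M *v v))\<^sup>2 = (sing_val CARD('n) M)\<^sup>2 * (norm v)\<^sup>2"
proof -
  obtain B where B: "pairwise orthogonal B" "\<And>v. v \<in> B \<Longrightarrow> norm v = 1"
    "pairwise (\<lambda>v w. orthogonal (M *v v) (M *v w)) B" "card B = CARD('n)" "finite B"
    using right_singular_basis[of "(*v) M" UNIV] by (auto simp: DIM_cart)
  obtain q where q: "bij_betw q (UNIV :: 'n set) B"
    using B(4,5) by (metis finite_class.finite_UNIV finite_same_card_bij)
  define Q :: "real^'n^'n" where "Q = (\<chi> i j. q j $ i)"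
  have colQ: "column j Q = q j" for j by (simp add: Q_def column_def vec_eq_iff)
  have qB: "q j \<in> B" for j using q by (auto simp: bij_betw_def)
  have q_orth: "i \<noteq> j \<Longrightarrow> orthogonal (q i) (q j)" "i \<noteq> j \<Longrightarrow> orthogonal (M *v q i) (M *v q j)" for i j
    using B(1,3) qB q unfolding pairwise_def bij_betw_def inj_on_def by blast+
  have Q: "orthogonal_matrix Q"
    using q_orth B(2) qB by (auto simp: orthogonal_matrix_orthonormal_columns colQ)
  have ent: "(transpose Q ** (transpose M ** M) ** Q) $ i $ j = (M *v q i) \<bullet> (M *v q j)" for i j
  proof -
    have "transpose Q ** (transpose M ** M) ** Q = transpose (M ** Q) ** (M ** Q)"
      by (simp add: matrix_transpose_mul matrix_mul_assoc)
    moreover have "column j (M ** Q) = M *v q j" for j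
      by (simp add: Q_def column_def vec_eq_iff matrix_matrix_mult_def matrix_vector_mult_def)
    ultimately show ?thesis by (simp add: matrix_mult_transpose_dot_column)
  qed
  define D where "D i = (norm (M *v q i))\<^sup>2" for i
  have "char_poly_mat (transpose M ** M) = (\<Prod>i\<in>UNIV. [:- D i, 1:])"
    using char_poly_of_diagonalised[OF Q, of "transpose M ** M"] q_orth
    by (simp add: ent D_def power2_norm_eq_inner orthogonal_def)
  then have "proots (char_poly_mat (transpose M ** M)) = (\<Sum>i\<in>UNIV. {#D i#})"
    by (simp add: proots_prod)
  moreover have "(\<Sum>i\<in>S. {#D i#}) = image_mset D (mset_set S)" for S :: "'n set"
    by (induction S rule: infinite_finite_induct) auto
  ultimately have sv: "singular_values M = image_mset (\<lambda>i. norm (M *v q i)) (mset_set UNIV)"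
    by (simp add: singular_values_def multiset.map_comp comp_def D_def)
  define xs where "xs = sorted_list_of_multiset (singular_values M)"
  have mset_xs: "mset xs = singular_values M" by (simp add: xs_def)
  have "length xs = CARD('n)" by (simp add: size_mset[symmetric] mset_xs sv del: size_mset)
  moreover define \<sigma> where "\<sigma> = sing_val CARD('n) M"
  ultimately have \<sigma>: "\<sigma> = xs ! 0" and ne: "xs \<noteq> []"
    by (auto simp: sing_val_def xs_def[symmetric] rev_nth)
  have set_xs: "set xs = range (\<lambda>i. norm (M *v q i))"
    by (simp add: set_mset_mset[symmetric] mset_xs sv del: set_mset_mset)
  have "\<sigma> \<in> set xs" using ne by (simp add: \<sigma>)
  then obtain i0 where i0: "\<sigma> = norm (M *v q i0)" using set_xs by auto
  have "sorted xs" by (simp add: xs_def)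
  then have "\<sigma> \<le> y" if "y \<in> set xs" for y
    using that ne by (cases xs) (auto simp: \<sigma>)
  then have le: "\<sigma> \<le> norm (M *v q i)" for i using set_xs by auto
  show "sing_val CARD('n) M \<ge> 0" using i0 by (simp add: \<sigma>_def)
  have "norm (q i0) = 1" using B(2) qB by simp
  then show "\<exists>v. v \<noteq> 0 \<and> (norm (M *v v))\<^sup>2 = (sing_val CARD('n) M)\<^sup>2 * (norm v)\<^sup>2"
    using i0 by (intro exI[of _ "q i0"]) (auto simp: \<sigma>_def)
  define c where "c i = q i \<bullet> v" for i
  have expand: "v = (\<Sum>i\<in>UNIV. c i *\<^sub>R q i)"
  proof -
    have "Q *v (transpose Q *v v) = v"
      using Q by (simp add: orthogonal_matrix_def matrix_vector_mul_assoc del: transpose_matrix_vector)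
    moreover have "(transpose Q *v v) $ i = c i" for i
      by (simp add: Q_def c_def transpose_def matrix_vector_mul_component inner_vec_def
          del: transpose_matrix_vector)
    ultimately show ?thesis
      by (simp add: matrix_mult_sum colQ scalar_mult_eq_scaleR del: transpose_matrix_vector)
  qed
  have pyth: "(norm (\<Sum>i\<in>UNIV. c i *\<^sub>R f i))\<^sup>2 = (\<Sum>i\<in>UNIV. (c i)\<^sup>2 * (norm (f i))\<^sup>2)"
    if "\<And>i j. i \<noteq> j \<Longrightarrow> orthogonal (f i) (f j)" for f :: "'n \<Rightarrow> real^'k"
    using that by (subst norm_sum_Pythagorean)
      (auto simp: pairwise_def orthogonal_def power_mult_distrib)
  have "\<sigma>\<^sup>2 * (norm v)\<^sup>2 = (\<Sum>i\<in>UNIV. (c i)\<^sup>2 * \<sigma>\<^sup>2)"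
    using pyth[of q, OF q_orth(1)] B(2) qB
    by (simp add: expand[symmetric] sum_distrib_left mult.commute)
  also have "\<dots> \<le> (\<Sum>i\<in>UNIV. (c i)\<^sup>2 * (norm (M *v q i))\<^sup>2)"
    using le i0 by (intro sum_mono mult_left_mono power_mono) auto
  also have "\<dots> = (norm (\<Sum>i\<in>UNIV. c i *\<^sub>R (M *v q i)))\<^sup>2"
    using pyth[of "\<lambda>i. M *v q i", OF q_orth(2)] by simp
  also have "(\<Sum>i\<in>UNIV. c i *\<^sub>R (M *v q i)) = M *v v"
    using arg_cong[OF expand, of "(*v) M"]
    by (simp add: linear_sum[OF matrix_vector_mul_linear] matrix_vector_mult_scaleR)
  finally show "(sing_val CARD('n) M)\<^sup>2 * (norm v)\<^sup>2 \<le> (norm (M *v v))\<^sup>2"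
    by (simp add: \<sigma>_def)
qed

section \<open>Block matrices and matrices of rank one\<close>

lemma norm_matrix_vector_le: "norm (M *v v) \<le> norm M * norm v" for M :: "real^'n^'m"
proof -
  have "norm (M *v v) = L2_set (\<lambda>i. \<bar>M $ i \<bullet> v\<bar>) UNIV"
    by (simp add: norm_vec_def matrix_vector_mul_component)
  also have "\<dots> \<le> L2_set (\<lambda>i. norm v * norm (M $ i)) UNIV"
    by (intro L2_set_mono) (simp_all add: Cauchy_Schwarz_ineq2 mult.commute[of "norm v"])
  also have "\<dots> = norm M * norm v"
    by (simp add: L2_set_right_distrib[symmetric] norm_vec_def mult.commute)
  finally show ?thesis .
qed

lemma norm_transpose: "norm (transpose M) = norm M" for M :: "real^'n^'m"
proof -
  have "(norm (transpose M))\<^sup>2 = (norm M)\<^sup>2"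
    unfolding power2_norm_eq_inner inner_vec_def transpose_def
    by simp (rule sum.swap)
  then show ?thesis by simp
qed

lemma norm_vector_matrix_le: "norm (v v* M) \<le> norm M * norm v" for M :: "real^'n^'m"
  using norm_matrix_vector_le[of "transpose M" v] by (simp add: norm_transpose)

lemma sum_UNIV_Plus: "(\<Sum>i\<in>(UNIV :: ('a::finite + 'b::finite) set). f i)
    = (\<Sum>i\<in>UNIV. f (Inl i)) + (\<Sum>i\<in>UNIV. f (Inr i))"
  unfolding UNIV_Plus_UNIV[symmetric] by (subst sum.Plus) (auto simp: comp_def)

lemma vcat_nth [simp]: "vcat u v $ Inl i = u $ i" "vcat u v $ Inr j = v $ j"
  by (simp_all add: vcat_def)

lemma parts_vcat [simp]: "top_part (vcat u v) = u" "bottom_part (vcat u v) = v"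
  by (simp_all add: top_part_def bottom_part_def vec_eq_iff)

lemma vcat_parts: "vcat (top_part u) (bottom_part u) = u"
  by (simp add: vcat_def top_part_def bottom_part_def vec_eq_iff split: sum.split)

lemma inner_vcat: "vcat u v \<bullet> vcat u' v' = u \<bullet> u' + v \<bullet> v'"
  by (simp add: inner_vec_def sum_UNIV_Plus)

lemma inner_parts: "u \<bullet> v = top_part u \<bullet> top_part v + bottom_part u \<bullet> bottom_part v"
  by (simp add: inner_vec_def sum_UNIV_Plus top_part_def bottom_part_def)

lemma norm_parts_sq: "(norm u)\<^sup>2 = (norm (top_part u))\<^sup>2 + (norm (bottom_part u))\<^sup>2"
  for u :: "'a::real_inner^('m::finite + 'k::finite)"
  by (simp add: power2_norm_eq_inner inner_parts)

lemma norm_part_le: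
  fixes u :: "'a::real_inner^('m::finite + 'k::finite)"
  shows "norm (top_part u) \<le> norm u" "norm (bottom_part u) \<le> norm u"
  using norm_parts_sq[of u] by (simp_all add: power2_le_imp_le)

lemma linear_parts: "linear top_part" "linear bottom_part"
  by (auto intro!: linearI simp: top_part_def bottom_part_def vec_eq_iff)

lemmas parts_simps = linear_add[OF linear_parts(1)] linear_add[OF linear_parts(2)]
  linear_diff[OF linear_parts(1)] linear_diff[OF linear_parts(2)]
  linear_scale[OF linear_parts(1)] linear_scale[OF linear_parts(2)]
  linear_0[OF linear_parts(1)] linear_0[OF linear_parts(2)]
  linear_neg[OF linear_parts(1)] linear_neg[OF linear_parts(2)]

lemma parts_mult: "top_part (M *v v) = top_part M *v v" "bottom_part (M *v v) = bottom_part M *v v"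
  by (simp_all add: top_part_def bottom_part_def vec_eq_iff matrix_vector_mult_def)

lemma vcat_mult: "vcat M N *v v = vcat (M *v v) (N *v v)"
  by (simp add: vcat_def vec_eq_iff matrix_vector_mult_def split: sum.split)

lemma hcat_mult: "hcat M N *v v = M *v top_part v + N *v bottom_part v"
  by (simp add: hcat_def top_part_def bottom_part_def vec_eq_iff matrix_vector_mult_def sum_UNIV_Plus)

lemma vector_mult_hcat: "v v* hcat M N = vcat (v v* M) (v v* N)"
  by (simp add: hcat_def vcat_def vec_eq_iff vector_matrix_mult_def split: sum.split)

lemma vector_mult_parts: "t v* M = top_part t v* top_part M + bottom_part t v* bottom_part M"
  by (simp add: vec_eq_iff vector_matrix_mult_def sum_UNIV_Plus top_part_def bottom_part_def)

lemma append_col_mult: "append_col M u *v v = M *v top_part v + (v $ Inr 1) *\<^sub>R u"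
  for M :: "real^'n^'m"
proof -
  have "columnvector u *v w = (w $ 1) *\<^sub>R u" for w :: "real^1"
    by (simp add: vec_eq_iff matrix_vector_mult_def columnvector_def)
  then show ?thesis by (simp add: append_col_def hcat_mult bottom_part_def)
qed

lemma vector_mult_append_col: "v v* append_col M u = vcat (v v* M) (\<chi> i. v \<bullet> u)"
  for M :: "real^'n^'m"
proof -
  have "v v* columnvector u = (\<chi> i::1. v \<bullet> u)"
    by (simp add: vec_eq_iff vector_matrix_mult_def columnvector_def inner_vec_def mult.commute)
  then show ?thesis by (simp add: append_col_def vector_mult_hcat)
qed

lemma outer_nth: "outer u v $ i $ j = u $ i * v $ j"
  by (simp add: outer_def matrix_matrix_mult_def columnvector_def rowvector_def)

lemma outer_mult: "outer u v *v w = (v \<bullet> w) *\<^sub>R u"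
  by (simp add: vec_eq_iff matrix_vector_mult_def outer_nth inner_vec_def sum_distrib_right)
    (simp add: mult_ac)

lemma vector_mult_outer: "w v* outer u v = (w \<bullet> u) *\<^sub>R v"
  by (simp add: vec_eq_iff vector_matrix_mult_def outer_nth inner_vec_def sum_distrib_right)
    (simp add: mult_ac)

lemma inner_outer: "M \<bullet> outer u v = u \<bullet> (M *v v)"
  by (simp add: matrix_vector_mult_def outer_nth inner_vec_def sum_distrib_left)
    (simp add: mult_ac)

lemma norm_outer: "norm (outer u v) = norm u * norm v"
proof -
  have "(norm (outer u v))\<^sup>2 = (norm u * norm v)\<^sup>2"
    unfolding power_mult_distrib power2_norm_eq_inner inner_outer outer_mult by simp
  then show ?thesis by (rule power2_eq_imp_eq) simp_all
qed

lemma scaleR_mult: "(c *\<^sub>R M) *v v = c *\<^sub>R (M *v v)" for M :: "real^'n^'m"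
  by (rule scaleR_matrix_vector_assoc[symmetric])

lemma norm_append_col_sq: "(norm (append_col M v))\<^sup>2 = (norm M)\<^sup>2 + (norm v)\<^sup>2"
  for M :: "real^'n^'m"
  unfolding power2_norm_eq_inner
  by (simp add: append_col_def hcat_def columnvector_def inner_vec_def sum_UNIV_Plus sum.distrib)

section \<open>Total least squares as a quotient minimisation\<close>

text \<open>
  A correction must satisfy \<open>E x - f = b - A x\<close>, that is \<open>[E f]\<close> maps \<open>(x, -1)\<close> to \<open>b - A x\<close>. The norm of
  \<open>[E f]\<close> is therefore at least \<open>|A x - b| / \<surd>(1 + |x|\<^sup>2)\<close>, and the matrix of rank one with this property
  attains the bound.
\<close>

lemma smallest_tls_correction:
  fixes A :: "real^'n^'q"
  shows "(A + E) *v x = b + f \<Longrightarrow>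
      (norm (A *v x - b))\<^sup>2 / (1 + (norm x)\<^sup>2) \<le> (norm (append_col E f))\<^sup>2"
    and "\<exists>E f. (A + E) *v x = b + f \<and>
      (norm (append_col E f))\<^sup>2 = (norm (A *v x - b))\<^sup>2 / (1 + (norm x)\<^sup>2)"
proof -
  have pos: "1 + (norm x)\<^sup>2 > 0" by (simp add: add_pos_nonneg)
  {
    assume "(A + E) *v x = b + f"
    then have "A *v x - b = f - E *v x" by (simp add: algebra_simps)
    then have "norm (A *v x - b) \<le> norm f + norm E * norm x"
      using norm_triangle_ineq4[of f "E *v x"] norm_matrix_vector_le[of E x] by simp
    then have "(norm (A *v x - b))\<^sup>2 \<le> (norm f * 1 + norm E * norm x)\<^sup>2"
      by (intro power_mono) auto
    also have "\<dots> \<le> ((norm f)\<^sup>2 + (norm E)\<^sup>2) * (1\<^sup>2 + (norm x)\<^sup>2)"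
    proof -
      have "(f1\<^sup>2 + e\<^sup>2) * (1\<^sup>2 + y\<^sup>2) - (f1 * 1 + e * y)\<^sup>2 = (f1 * y - e)\<^sup>2" for f1 e y :: real
        by (simp add: power2_eq_square algebra_simps)
      from this[of "norm f" "norm E" "norm x"] show ?thesis
        using zero_le_power2[of "norm f * norm x - norm E"] by linarith
    qed
    finally show "(norm (A *v x - b))\<^sup>2 / (1 + (norm x)\<^sup>2) \<le> (norm (append_col E f))\<^sup>2"
      using pos by (simp add: norm_append_col_sq field_simps)
  }
  define r where "r = A *v x - b"
  define c where "c = 1 / (1 + (norm x)\<^sup>2)"
  \<comment> \<open>\<open>E\<close> and \<open>c r\<close> form the matrix that maps \<open>(x, -1)\<close> to \<open>- r\<close> and vanishes on its orthogonal complement\<close>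
  define E where "E = (- c) *\<^sub>R outer r x"
  have "(A + E) *v x = b + c *\<^sub>R r"
  proof -
    have "(A + E) *v x = A *v x - (c * (norm x)\<^sup>2) *\<^sub>R r"
      by (simp add: E_def matrix_vector_mult_diff_rdistrib scaleR_mult outer_mult power2_norm_eq_inner)
    also have "c * (norm x)\<^sup>2 = 1 - c" using pos by (simp add: c_def field_simps)
    also have "A *v x - (1 - c) *\<^sub>R r = b + c *\<^sub>R r" by (simp add: r_def scaleR_left_diff_distrib)
    finally show ?thesis .
  qed
  moreover have "(norm (append_col E (c *\<^sub>R r)))\<^sup>2 = (norm r)\<^sup>2 / (1 + (norm x)\<^sup>2)"
  proof -
    have "(norm (append_col E (c *\<^sub>R r)))\<^sup>2 = (c * (norm r * norm x))\<^sup>2 + (c * norm r)\<^sup>2"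
      unfolding norm_append_col_sq E_def norm_scaleR norm_outer by (simp add: power_mult_distrib)
    also have "\<dots> = (c * (1 + (norm x)\<^sup>2)) * (c * (norm r)\<^sup>2)"
      by (simp add: power2_eq_square algebra_simps)
    also have "c * (1 + (norm x)\<^sup>2) = 1" using pos by (simp add: c_def)
    finally show ?thesis by (simp add: c_def)
  qed
  ultimately show "\<exists>E f. (A + E) *v x = b + f \<and>
      (norm (append_col E f))\<^sup>2 = (norm (A *v x - b))\<^sup>2 / (1 + (norm x)\<^sup>2)"
    unfolding r_def by blast
qed

lemma is_tlse_solution_iff:
  "is_tlse_solution A b C d x \<longleftrightarrow> C *v x = d \<and>
     (\<forall>x'. C *v x' = d \<longrightarrow>
        (norm (A *v x - b))\<^sup>2 / (1 + (norm x)\<^sup>2) \<le> (norm (A *v x' - b))\<^sup>2 / (1 + (norm x')\<^sup>2))"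
    (is "?L \<longleftrightarrow> ?R")
proof
  assume ?L
  then obtain E f where ef: "tlse_feasible A b C d E f x"
    and min: "\<And>E' f' x'. tlse_feasible A b C d E' f' x' \<Longrightarrow> norm (append_col E f) \<le> norm (append_col E' f')"
    unfolding is_tlse_solution_def by blast
  have "(norm (A *v x - b))\<^sup>2 / (1 + (norm x)\<^sup>2) \<le> (norm (A *v x' - b))\<^sup>2 / (1 + (norm x')\<^sup>2)"
    if "C *v x' = d" for x'
  proof -
    obtain E' f' where "(A + E') *v x' = b + f'"
      "(norm (append_col E' f'))\<^sup>2 = (norm (A *v x' - b))\<^sup>2 / (1 + (norm x')\<^sup>2)"
      using smallest_tls_correction(2) by blast
    moreover from this that have "norm (append_col E f) \<le> norm (append_col E' f')"
      by (intro min) (auto simp: tlse_feasible_def)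
    then have "(norm (append_col E f))\<^sup>2 \<le> (norm (append_col E' f'))\<^sup>2"
      by (simp add: power_mono)
    ultimately show ?thesis
      using smallest_tls_correction(1)[of A E x b f] ef by (auto simp: tlse_feasible_def)
  qed
  then show ?R using ef by (auto simp: tlse_feasible_def)
next
  assume R: ?R
  obtain E f where Ef: "(A + E) *v x = b + f"
      "(norm (append_col E f))\<^sup>2 = (norm (A *v x - b))\<^sup>2 / (1 + (norm x)\<^sup>2)"
    using smallest_tls_correction(2) by blast
  have "norm (append_col E f) \<le> norm (append_col E' f')"
    if "tlse_feasible A b C d E' f' x'" for E' f' x'
  proof (rule power2_le_imp_le)
    show "(norm (append_col E f))\<^sup>2 \<le> (norm (append_col E' f'))\<^sup>2"
      using smallest_tls_correction(1)[of A E' x' b f'] that R Ef(2)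
      by (force simp: tlse_feasible_def)
  qed simp
  then show ?L using R Ef(1) unfolding is_tlse_solution_def tlse_feasible_def by blast
qed

section \<open>The homogeneous problem\<close>

definition hom_res :: "real^'n^'m \<Rightarrow> real^'m \<Rightarrow> (real^'n) \<times> real \<Rightarrow> real^'m" where
  "hom_res L h z = L *v fst z - snd z *\<^sub>R h"

definition hom_feasible :: "real^'n^('p::finite + 'q::finite) \<Rightarrow> real^('p + 'q) \<Rightarrow> ((real^'n) \<times> real) set" where
  "hom_feasible L h = {z. top_part (hom_res L h z) = 0}"

definition hom_minimiser ::
    "real^'n^('p::finite + 'q::finite) \<Rightarrow> real^('p + 'q) \<Rightarrow> real \<Rightarrow> (real^'n) \<times> real \<Rightarrow> bool" where
  "hom_minimiser L h s z \<longleftrightarrow> z \<in> hom_feasible L h \<and>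
     (norm (hom_res L h z))\<^sup>2 = s * (norm z)\<^sup>2 \<and>
     (\<forall>w \<in> hom_feasible L h. s * (norm w)\<^sup>2 \<le> (norm (hom_res L h w))\<^sup>2)"

lemma linear_hom_res: "linear (hom_res L h)"
  by (auto intro!: linearI simp: hom_res_def algebra_simps)

lemma subspace_hom_feasible: "subspace (hom_feasible L h)"
  unfolding hom_feasible_def
  using linear_subspace_kernel[OF linear_compose[OF linear_hom_res linear_parts(1)]]
  by (simp add: comp_def)

lemma tendsto_mult_vec [tendsto_intros]:
  fixes M :: "'x \<Rightarrow> real^'n^'m"
  assumes "(M \<longlongrightarrow> M0) F" "(v \<longlongrightarrow> v0) F"
  shows "((\<lambda>k. M k *v v k) \<longlongrightarrow> M0 *v v0) F"
  by (rule vec_tendstoI, unfold matrix_vector_mult_def vec_lambda_beta,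
      intro tendsto_sum tendsto_mult tendsto_vec_nth assms)

lemma tendsto_vec_mult [tendsto_intros]:
  fixes M :: "'x \<Rightarrow> real^'n^'m"
  assumes "(M \<longlongrightarrow> M0) F" "(v \<longlongrightarrow> v0) F"
  shows "((\<lambda>k. v k v* M k) \<longlongrightarrow> v0 v* M0) F"
  by (rule vec_tendstoI, unfold vector_matrix_mult_def vec_lambda_beta,
      intro tendsto_sum tendsto_mult tendsto_vec_nth assms)

lemma tendsto_parts [tendsto_intros]:
  assumes "(u \<longlongrightarrow> u0) F"
  shows "((\<lambda>k. top_part (u k)) \<longlongrightarrow> top_part u0) F"
    "((\<lambda>k. bottom_part (u k)) \<longlongrightarrow> bottom_part u0) F"
  by (rule vec_tendstoI, unfold top_part_def bottom_part_def vec_lambda_beta,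
      rule tendsto_vec_nth[OF assms])+

lemma tendsto_hom_res [tendsto_intros]:
  assumes "(L \<longlongrightarrow> L0) F" "(h \<longlongrightarrow> h0) F" "(z \<longlongrightarrow> z0) F"
  shows "((\<lambda>k. hom_res (L k) (h k) (z k)) \<longlongrightarrow> hom_res L0 h0 z0) F"
  unfolding hom_res_def by (intro tendsto_intros assms)

text \<open>
  Minimisers for \<open>s\<close> are the zeros of the nonnegative quadratic form \<open>|G w|\<^sup>2 - s |w|\<^sup>2\<close>, and these form a
  linear space: the mixed term vanishes by stationarity.
\<close>

lemma hom_minimiser_lincomb:
  assumes "hom_minimiser L h s z" "hom_minimiser L h s w"
  shows "hom_minimiser L h s (a *\<^sub>R z + c *\<^sub>R w)"
proof -
  note V = subspace_hom_feasible[of L h] and G = linear_hom_res[of L h]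
  have "hom_res L h z \<bullet> hom_res L h w = s * (z \<bullet> w)"
    using assms by (intro rayleigh_minimiser_stationary[OF G V]) (auto simp: hom_minimiser_def)
  then have "(norm (a *\<^sub>R hom_res L h z + c *\<^sub>R hom_res L h w))\<^sup>2 = s * (norm (a *\<^sub>R z + c *\<^sub>R w))\<^sup>2"
    using assms unfolding norm_add_scaleR_sq
    by (simp add: hom_minimiser_def power_mult_distrib algebra_simps)
  then show ?thesis
    using assms V by (auto simp: hom_minimiser_def linear_add[OF G] linear_scale[OF G]
        subspace_add subspace_scale)
qed

lemma hom_minimiser_scale: "hom_minimiser L h s z \<Longrightarrow> hom_minimiser L h s (a *\<^sub>R z)"
  using hom_minimiser_lincomb[of L h s z z a 0] by simp

lemma hom_minimiser_exists:
  fixes L :: "real^'n^('p::finite + 'q::finite)"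
  assumes "CARD('p) \<le> CARD('n)"
  obtains s z where "hom_minimiser L h s z" "norm z = 1"
proof -
  have "hom_feasible L h \<noteq> {0}"
  proof
    assume "hom_feasible L h = {0}"
    then have "inj (\<lambda>z. top_part (hom_res L h z))"
      using linear_injective_0[OF linear_compose[OF linear_hom_res linear_parts(1)], of L h]
      by (auto simp: comp_def hom_feasible_def)
    then have "dim (range (\<lambda>z. top_part (hom_res L h z))) = DIM((real^'n) \<times> real)"
      using dim_image_eq[of "\<lambda>z. top_part (hom_res L h z)" UNIV]
        linear_compose[OF linear_hom_res[of L h] linear_parts(1)] by (simp add: comp_def)
    moreover have "dim (range (\<lambda>z. top_part (hom_res L h z))) \<le> DIM(real^'p)"
      by (rule dim_subset_UNIV)
    ultimately show False using assms by simp
  qed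
  from rayleigh_minimiser_exists[OF linear_hom_res subspace_hom_feasible this]
  obtain z where "z \<in> hom_feasible L h" "norm z = 1"
    "\<And>w. w \<in> hom_feasible L h \<Longrightarrow> (norm (hom_res L h z))\<^sup>2 * (norm w)\<^sup>2 \<le> (norm (hom_res L h w))\<^sup>2"
    by blast
  then show thesis using that[of "(norm (hom_res L h z))\<^sup>2" z] by (simp add: hom_minimiser_def)
qed

lemma norm_affine_sq: "(norm (x :: real^'n, 1 :: real))\<^sup>2 = 1 + (norm x)\<^sup>2"
  by (simp add: norm_Pair)

lemma affine_feasible_iff: "(x, 1) \<in> hom_feasible L h \<longleftrightarrow> top_part L *v x = top_part h"
  by (simp add: hom_feasible_def hom_res_def parts_simps parts_mult)

lemma norm_hom_res_feasible:
  "z \<in> hom_feasible L h \<Longrightarrow>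
     (norm (hom_res L h z))\<^sup>2 = (norm (bottom_part L *v fst z - snd z *\<^sub>R bottom_part h))\<^sup>2"
  by (simp add: norm_parts_sq[of "hom_res L h z"] hom_feasible_def)
    (simp add: hom_res_def parts_simps parts_mult)

text \<open>
  Scaled to last component \<open>1\<close>, a minimiser is optimal among all such vectors, which is the TLSE problem.
  Uniqueness comes from the absence of horizontal minimisers, those with vanishing last component: if \<open>x\<close> and \<open>x\<^sub>0\<close> are solutions, then \<open>(x, 1)\<close> and \<open>(x\<^sub>0, 1)\<close> are minimisers, hence so is the
  horizontal vector \<open>(x - x\<^sub>0, 0)\<close>.
\<close>

lemma tlse_solution_iff_hom_minimiser:
  assumes z: "hom_minimiser L h s z" "snd z \<noteq> 0"
    and no_horizontal: "\<And>w. hom_minimiser L h s w \<Longrightarrow> snd w = 0 \<Longrightarrow> w = 0"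
  shows "is_tlse_solution (bottom_part L) (bottom_part h) (top_part L) (top_part h) x
    \<longleftrightarrow> x = fst z /\<^sub>R snd z"
proof -
  define x0 where "x0 = fst z /\<^sub>R snd z"
  have "inverse (snd z) *\<^sub>R z = (x0, 1)" using z(2) by (simp add: x0_def prod_eq_iff)
  with hom_minimiser_scale[OF z(1), of "inverse (snd z)"] have x0: "hom_minimiser L h s (x0, 1)" by simp
  define g where "g y = (norm (bottom_part L *v y - bottom_part h))\<^sup>2 / (1 + (norm y)\<^sup>2)" for y
  have pos: "1 + (norm y)\<^sup>2 > 0" for y :: "real^'a" by (simp add: add_pos_nonneg)
  have res: "(norm (hom_res L h (y, 1)))\<^sup>2 = g y * (norm (y, 1::real))\<^sup>2"
    if "top_part L *v y = top_part h" for y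
    using pos[of y] that norm_hom_res_feasible[of "(y,1)" L h] unfolding norm_affine_sq
    by (simp add: affine_feasible_iff g_def)
  have Cx0: "top_part L *v x0 = top_part h"
    using x0 by (simp add: hom_minimiser_def affine_feasible_iff[symmetric])
  have np: "(norm (y, 1::real))\<^sup>2 > 0" for y :: "real^'a" by (simp add: norm_affine_sq pos)
  have gx0: "g x0 = s" using x0 res[OF Cx0] np[of x0] by (simp add: hom_minimiser_def)
  have ge: "s \<le> g y" if "top_part L *v y = top_part h" for y
  proof (rule mult_right_le_imp_le[OF _ np])
    show "s * (norm (y, 1::real))\<^sup>2 \<le> g y * (norm (y, 1::real))\<^sup>2"
      unfolding res[OF that, symmetric]
      using x0 that by (simp add: hom_minimiser_def affine_feasible_iff)
  qed
  have "is_tlse_solution (bottom_part L) (bottom_part h) (top_part L) (top_part h) x \<longleftrightarrow>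
      top_part L *v x = top_part h \<and> (\<forall>y. top_part L *v y = top_part h \<longrightarrow> g x \<le> g y)"
    by (simp add: is_tlse_solution_iff g_def)
  also have "\<dots> \<longleftrightarrow> top_part L *v x = top_part h \<and> g x = s"
  proof (intro conj_cong refl iffI)
    assume "top_part L *v x = top_part h" "\<forall>y. top_part L *v y = top_part h \<longrightarrow> g x \<le> g y"
    then show "g x = s" using ge[of x] Cx0 gx0 by force
  qed (use ge in simp)
  also have "\<dots> \<longleftrightarrow> hom_minimiser L h s (x, 1)"
  proof (cases "top_part L *v x = top_part h")
    case True
    have "g x * (norm (x, 1::real))\<^sup>2 = s * (norm (x, 1::real))\<^sup>2 \<longleftrightarrow> g x = s"
      using np[of x] by simp
    then show ?thesis
      using x0 True unfolding hom_minimiser_def affine_feasible_iff res[OF True] by blast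
  next
    case False
    then show ?thesis by (simp add: hom_minimiser_def affine_feasible_iff)
  qed
  also have "\<dots> \<longleftrightarrow> x = x0"
  proof
    assume "hom_minimiser L h s (x, 1)"
    from hom_minimiser_lincomb[OF this x0, of 1 "-1"] have "hom_minimiser L h s (x - x0, 0)" by simp
    from no_horizontal[OF this] show "x = x0" by (simp add: zero_prod_def)
  qed (use x0 in simp)
  finally show ?thesis by (simp add: x0_def)
qed

lemma tlse_map_eq_hom_minimiser:
  assumes z: "hom_minimiser L h s z" "z \<noteq> 0"
    and no_horizontal: "\<And>w. hom_minimiser L h s w \<Longrightarrow> snd w = 0 \<Longrightarrow> w = 0"
  shows "snd z \<noteq> 0" "tlse_map L h = fst z /\<^sub>R snd z" "hom_minimiser L h s (tlse_map L h, 1)"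
proof -
  show z0: "snd z \<noteq> 0" using assms by blast
  show eq: "tlse_map L h = fst z /\<^sub>R snd z"
    unfolding tlse_map_def
    by (rule the_equality) (simp_all only: tlse_solution_iff_hom_minimiser[OF z(1) z0 no_horizontal])
  have "inverse (snd z) *\<^sub>R z = (tlse_map L h, 1)" using z0 by (simp add: eq prod_eq_iff)
  with hom_minimiser_scale[OF z(1), of "inverse (snd z)"] show "hom_minimiser L h s (tlse_map L h, 1)"
    by simp
qed

lemma linear_vec_mult: "linear (\<lambda>v. v v* M)" for M :: "real^'n^'m"
  using matrix_vector_mul_linear[of "transpose M"] by simp

text \<open>
  The solution of least norm is \<open>u = C\<^sup>T m\<close> with \<open>C C\<^sup>T m = v\<close>. Its bound depends only on the constant \<open>c\<close>,
  which by the next lemma is at most halved by a small change of \<open>C\<close>.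
\<close>

lemma right_inverse_bound:
  fixes C :: "real^'n^'p"
  assumes c: "c > 0" "\<And>m. c * norm m \<le> norm (m v* C)"
  obtains u where "C *v u = v" "c * norm u \<le> norm v"
proof -
  define f where "f m = C *v (m v* C)" for m
  have lin: "linear f"
    using linear_compose[OF linear_vec_mult[of C] matrix_vector_mul_linear[of C]]
    by (simp add: f_def[abs_def] comp_def)
  have inner: "m \<bullet> f m = (norm (m v* C))\<^sup>2" for m
    by (simp add: f_def dot_lmul_matrix power2_norm_eq_inner)
  have "inj f"
  proof (subst linear_injective_0[OF lin], intro allI impI)
    fix m assume "f m = 0"
    then have "m v* C = 0" using inner[of m] by simp
    then show "m = 0" using c(1) c(2)[of m] by (simp add: mult_le_0_iff)
  qed
  then obtain m where m: "f m = v" using linear_injective_imp_surjective[OF lin] by (metis surjD)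
  define u where "u = m v* C"
  have "(norm u)\<^sup>2 \<le> norm m * norm v"
    using inner[of m] norm_cauchy_schwarz[of m v] by (simp add: u_def m)
  then have "c * (norm u)\<^sup>2 \<le> (c * norm m) * norm v"
    using c(1) by (simp add: mult.assoc)
  also have "\<dots> \<le> norm u * norm v" using c(2)[of m] by (simp add: u_def mult_right_mono)
  finally have "norm u * (c * norm u) \<le> norm u * norm v" by (simp add: power2_eq_square mult_ac)
  then have "c * norm u \<le> norm v" by (cases "u = 0") auto
  then show thesis using that[of u] m by (simp add: f_def u_def)
qed

lemma lower_bound_perturbed:
  fixes C C' :: "real^'n^'p"
  assumes "\<And>m. c * norm m \<le> norm (m v* C)" "norm (C' - C) \<le> c / 2"
  shows "c / 2 * norm m \<le> norm (m v* C')"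
proof -
  have "norm (m v* C) \<le> norm (m v* C') + norm (m v* (C' - C))"
    using norm_triangle_ineq4[of "m v* C'" "m v* (C' - C)"] by (simp add: algebra_simps)
  also have "norm (m v* (C' - C)) \<le> c / 2 * norm m"
    using norm_vector_matrix_le[of m "C' - C"] assms(2) by (meson mult_right_mono norm_ge_zero order_trans)
  finally show ?thesis using assms(1)[of m] by (simp add: field_simps)
qed

section \<open>Stability of the minimiser\<close>

text \<open>
  The feasible spaces vary with the data. A competitor \<open>w\<close> of the limit problem is corrected by a vector
  \<open>u k\<close>, of norm at most a multiple of its infeasibility, to a competitor of the \<open>k\<close>-th problem; since the
  infeasibility tends to \<open>0\<close>, the minimality inequalities pass to the limit.
\<close>

lemma limit_of_hom_minimisers:
  fixes L :: "real^'n^('p::finite + 'q::finite)"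
  assumes c: "c > 0" "\<And>m. c * norm m \<le> norm (m v* top_part L)"
    and L: "Lk \<longlonglongrightarrow> L" and h: "hk \<longlonglongrightarrow> h" and z: "zk \<longlonglongrightarrow> z"
    and min: "\<And>k. hom_minimiser (Lk k) (hk k) (sk k) (zk k)" and unit: "\<And>k. norm (zk k) = 1"
  shows "hom_minimiser L h ((norm (hom_res L h z))\<^sup>2) z" "norm z = 1"
proof -
  have sk: "sk k = (norm (hom_res (Lk k) (hk k) (zk k)))\<^sup>2" for k
    using min[of k] unit[of k] by (simp add: hom_minimiser_def)
  have s_lim: "sk \<longlonglongrightarrow> (norm (hom_res L h z))\<^sup>2"
    unfolding sk by (intro tendsto_intros L h z)
  have "(\<lambda>k. norm (zk k)) \<longlonglongrightarrow> norm z" by (intro tendsto_intros z)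
  then show norm_z: "norm z = 1" using unit by (simp add: LIMSEQ_const_iff)
  have "(\<lambda>k. top_part (hom_res (Lk k) (hk k) (zk k))) \<longlonglongrightarrow> top_part (hom_res L h z)"
    by (intro tendsto_intros L h z)
  then have z_feas: "z \<in> hom_feasible L h"
    using min by (simp add: hom_minimiser_def hom_feasible_def LIMSEQ_const_iff)
  have "(norm (hom_res L h z))\<^sup>2 * (norm w)\<^sup>2 \<le> (norm (hom_res L h w))\<^sup>2" if w: "w \<in> hom_feasible L h" for w
  proof -
    define v where "v k = - top_part (hom_res (Lk k) (hk k) w)" for k
    have "v \<longlonglongrightarrow> - top_part (hom_res L h w)"
      unfolding v_def by (intro tendsto_intros L h)
    then have v0: "v \<longlonglongrightarrow> 0" using w by (simp add: hom_feasible_def)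
    have "(\<lambda>k. norm (top_part (Lk k) - top_part L)) \<longlonglongrightarrow> norm (top_part L - top_part L)"
      by (intro tendsto_intros L)
    then have near: "\<forall>\<^sub>F k in sequentially. norm (top_part (Lk k) - top_part L) < c / 2"
      using c(1) by (intro order_tendstoD(2)) auto
    have ex: "\<exists>u. norm (top_part (Lk k) - top_part L) < c / 2 \<longrightarrow>
        top_part (Lk k) *v u = v k \<and> c / 2 * norm u \<le> norm (v k)" for k
      using right_inverse_bound[of "c / 2" "top_part (Lk k)" "v k"] c(1)
        lower_bound_perturbed[of c "top_part L" "top_part (Lk k)"] c(2) by (metis half_gt_zero less_imp_le)
    then obtain u where u: "\<And>k. norm (top_part (Lk k) - top_part L) < c / 2 \<Longrightarrow>
        top_part (Lk k) *v u k = v k \<and> c / 2 * norm (u k) \<le> norm (v k)" by metis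
    have "\<forall>\<^sub>F k in sequentially. norm (u k) \<le> 2 / c * norm (v k)"
      using near by eventually_elim (use u c(1) in \<open>force simp: field_simps\<close>)
    moreover have "(\<lambda>k. 2 / c * norm (v k)) \<longlonglongrightarrow> 0"
      using tendsto_mult_right_zero[OF tendsto_norm_zero[OF v0]] by blast
    ultimately have u0: "u \<longlonglongrightarrow> 0" by (rule Lim_null_comparison)
    define wk where "wk k = w + (u k, 0)" for k
    have "(\<lambda>k. w + (u k, 0::real)) \<longlonglongrightarrow> w + (0, 0)" by (intro tendsto_intros u0)
    then have wk: "wk \<longlonglongrightarrow> w" by (simp add: wk_def[abs_def] zero_prod_def[symmetric])
    have "\<forall>\<^sub>F k in sequentially. sk k * (norm (wk k))\<^sup>2 \<le> (norm (hom_res (Lk k) (hk k) (wk k)))\<^sup>2"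
      using near
    proof eventually_elim
      case (elim k)
      have "hom_res (Lk k) (hk k) (wk k) = hom_res (Lk k) (hk k) w + Lk k *v u k"
        by (simp add: hom_res_def wk_def algebra_simps)
      then have "wk k \<in> hom_feasible (Lk k) (hk k)"
        using u[OF elim] by (simp add: hom_feasible_def parts_simps parts_mult v_def)
      then show ?case using min[of k] by (simp add: hom_minimiser_def)
    qed
    moreover have "(\<lambda>k. sk k * (norm (wk k))\<^sup>2) \<longlonglongrightarrow> (norm (hom_res L h z))\<^sup>2 * (norm w)\<^sup>2"
      by (intro tendsto_intros s_lim wk)
    moreover have "(\<lambda>k. (norm (hom_res (Lk k) (hk k) (wk k)))\<^sup>2) \<longlonglongrightarrow> (norm (hom_res L h w))\<^sup>2"
      by (intro tendsto_intros L h wk)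
    ultimately show ?thesis using tendsto_le[OF trivial_limit_sequentially] by blast
  qed
  then show "hom_minimiser L h ((norm (hom_res L h z))\<^sup>2) z"
    using z_feas norm_z by (simp add: hom_minimiser_def)
qed

text \<open>
  By compactness of the unit sphere. If arbitrarily near data had a unit minimiser that is horizontal, or
  whose quotient is far from the solution, a subsequence of such minimisers would converge to a
  minimiser of the unperturbed problem with the same defect.
\<close>

lemma tlse_map_stable:
  fixes L :: "real^'n^('p::finite + 'q::finite)"
  assumes pn: "CARD('p) \<le> CARD('n)"
    and c: "c > 0" "\<And>m. c * norm m \<le> norm (m v* top_part L)"
    and no_horizontal: "\<And>s w. hom_minimiser L h s w \<Longrightarrow> snd w = 0 \<Longrightarrow> w = 0"
    and e: "e > 0"
  shows "\<forall>\<^sub>F D in nhds (L, h). (\<exists>s. hom_minimiser (fst D) (snd D) s (tlse_map (fst D) (snd D), 1)) \<and>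
     dist (tlse_map (fst D) (snd D)) (tlse_map L h) < e"
proof -
  define bad where "bad D \<longleftrightarrow> (\<exists>s z. hom_minimiser (fst D) (snd D) s z \<and> norm z = 1 \<and>
      (snd z = 0 \<or> dist (fst z /\<^sub>R snd z) (tlse_map L h) \<ge> e))"
    for D :: "(real^'n^('p + 'q)) \<times> (real^('p + 'q))"
  have good: "(\<exists>s. hom_minimiser (fst D) (snd D) s (tlse_map (fst D) (snd D), 1)) \<and>
     dist (tlse_map (fst D) (snd D)) (tlse_map L h) < e" if D: "\<not> bad D" for D
  proof -
    obtain s z where z: "hom_minimiser (fst D) (snd D) s z" "norm z = 1"
      using hom_minimiser_exists[OF pn] by blast
    have "w = 0" if w: "hom_minimiser (fst D) (snd D) s w" "snd w = 0" for w
    proof (rule ccontr)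
      assume "w \<noteq> 0"
      then have "norm (w /\<^sub>R norm w) = 1" "snd (w /\<^sub>R norm w) = 0" using w(2) by simp_all
      then show False
        using hom_minimiser_scale[OF w(1)] D unfolding bad_def by blast
    qed
    moreover have "z \<noteq> 0" using z(2) by auto
    ultimately have "tlse_map (fst D) (snd D) = fst z /\<^sub>R snd z"
      "hom_minimiser (fst D) (snd D) s (tlse_map (fst D) (snd D), 1)"
      using tlse_map_eq_hom_minimiser[OF z(1)] by blast+
    moreover have "dist (fst z /\<^sub>R snd z) (tlse_map L h) < e"
      using D z unfolding bad_def by (meson not_less)
    ultimately show ?thesis by auto
  qed
  have "\<forall>\<^sub>F k in sequentially. \<not> bad (Dk k)" if Dk: "Dk \<longlonglongrightarrow> (L, h)" for Dk
  proof (rule ccontr)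
    assume "\<not> (\<forall>\<^sub>F k in sequentially. \<not> bad (Dk k))"
    from not_eventually_sequentiallyD[OF this] obtain r where r: "strict_mono (r :: nat \<Rightarrow> nat)"
      "\<And>k. bad (Dk (r k))" by auto
    obtain s z where z: "\<And>k. hom_minimiser (fst (Dk (r k))) (snd (Dk (r k))) (s k) (z k)"
      "\<And>k. norm (z k) = 1"
      "\<And>k. snd (z k) = 0 \<or> dist (fst (z k) /\<^sub>R snd (z k)) (tlse_map L h) \<ge> e"
      using r(2) unfolding bad_def by metis
    have "\<forall>k. z k \<in> sphere 0 1" using z(2) by simp
    then obtain zl r' where zl: "zl \<in> sphere 0 1" "strict_mono (r' :: nat \<Rightarrow> nat)" "(z \<circ> r') \<longlonglongrightarrow> zl"
      using compact_sphere[of 0 1] unfolding compact_def by blast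
    have "(Dk \<circ> (r \<circ> r')) \<longlonglongrightarrow> (L, h)"
      by (intro LIMSEQ_subseq_LIMSEQ Dk strict_mono_o r zl)
    then have "(\<lambda>k. fst (Dk (r (r' k)))) \<longlonglongrightarrow> L" "(\<lambda>k. snd (Dk (r (r' k)))) \<longlonglongrightarrow> h"
      by (auto dest: tendsto_fst tendsto_snd simp: comp_def)
    note lim = limit_of_hom_minimisers[OF c this, of "\<lambda>k. z (r' k)" zl "\<lambda>k. s (r' k)"]
    have "hom_minimiser L h ((norm (hom_res L h zl))\<^sup>2) zl" "zl \<noteq> 0"
      using lim zl(1,3) z by (auto simp: comp_def)
    note zl_min = tlse_map_eq_hom_minimiser[OF this no_horizontal]
    have zr: "(\<lambda>k. z (r' k)) \<longlonglongrightarrow> zl" using zl(3) by (simp add: comp_def)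
    have "(\<lambda>k. snd (z (r' k))) \<longlonglongrightarrow> snd zl" by (intro tendsto_intros zr)
    then have "\<forall>\<^sub>F k in sequentially. snd (z (r' k)) \<noteq> 0"
      using zl_min(1) by (rule tendsto_imp_eventually_ne)
    moreover have "(\<lambda>k. dist (fst (z (r' k)) /\<^sub>R snd (z (r' k))) (tlse_map L h)) \<longlonglongrightarrow>
        dist (fst zl /\<^sub>R snd zl) (tlse_map L h)"
      by (intro tendsto_intros zr zl_min(1))
    then have "\<forall>\<^sub>F k in sequentially. dist (fst (z (r' k)) /\<^sub>R snd (z (r' k))) (tlse_map L h) < e"
      using e zl_min(2) by (intro order_tendstoD(2)) auto
    ultimately have "\<forall>\<^sub>F k in sequentially. False"
      by eventually_elim (use z(3) in \<open>meson not_less\<close>)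
    then show False by simp
  qed
  then have "\<forall>\<^sub>F D in inf (nhds (L, h)) (principal UNIV). \<not> bad D"
    by (intro sequentially_imp_eventually_nhds_within) auto
  then have "\<forall>\<^sub>F D in nhds (L, h). \<not> bad D" by simp
  then show ?thesis by eventually_elim (rule good)
qed

section \<open>Multipliers and the derivative of the solution map\<close>

lemma kernel_annihilator:
  fixes f :: "'a::euclidean_space \<Rightarrow> 'b::euclidean_space"
  assumes f: "linear f" and "\<And>w. f w = 0 \<Longrightarrow> y \<bullet> w = 0"
  obtains m where "y = adjoint f m"
proof -
  have "y \<in> (range (adjoint f))\<^sup>\<bottom>\<^sup>\<bottom>"
    using assms(2) unfolding ker_orthogonal_comp_adjoint[OF f, symmetric]
    by (auto simp: orthogonal_comp_def orthogonal_def inner_commute)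
  then have "y \<in> range (adjoint f)"
    using orthogonal_comp_self[of "range (adjoint f)"] adjoint_linear[OF f] linear_subspace_image subspace_UNIV
    by metis
  then show thesis using that by auto
qed

lemma inner_hom_res: "u \<bullet> hom_res L h z = (u v* L, - (u \<bullet> h)) \<bullet> z"
  by (cases z) (simp add: hom_res_def inner_diff_right dot_lmul_matrix)

text \<open>
  Stationarity says that \<open>G\<^sup>T R - s z\<close>, where \<open>R = G z\<close>, annihilates the kernel of the top block of \<open>G\<close>. It is
  therefore in the range of the adjoint of that block, and subtracting the preimage from the (vanishing)
  top block of \<open>R\<close> gives \<open>t\<close>.
\<close>

lemma tlse_multiplier:
  fixes L :: "real^'n^('p::finite + 'q::finite)"
  assumes "hom_minimiser L h s (x, 1)"
  obtains t where "t v* L = s *\<^sub>R x" "t \<bullet> h = - s" "bottom_part t = bottom_part (L *v x - h)"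
proof -
  let ?f = "\<lambda>w. top_part (hom_res L h w)"
  define R where "R = hom_res L h (x, 1)"
  have lin: "linear ?f" using linear_compose[OF linear_hom_res linear_parts(1)] by (simp add: comp_def)
  define y where "y = (R v* L, - (R \<bullet> h)) - s *\<^sub>R (x, 1)"
  have "y \<bullet> w = 0" if "?f w = 0" for w
  proof -
    have "R \<bullet> hom_res L h w = s * ((x, 1) \<bullet> w)" unfolding R_def
      using assms that
      by (intro rayleigh_minimiser_stationary[OF linear_hom_res subspace_hom_feasible])
        (auto simp: hom_minimiser_def hom_feasible_def)
    then show ?thesis by (simp only: y_def inner_diff_left inner_scaleR_left inner_hom_res[symmetric])
  qed
  from kernel_annihilator[OF lin this] obtain m where m: "y = adjoint ?f m" by blast
  define u where "u = vcat m (0 :: real^'q)"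
  have "y \<bullet> w = (u v* L, - (u \<bullet> h)) \<bullet> w" for w
  proof -
    have "y \<bullet> w = m \<bullet> ?f w" by (metis m adjoint_works[OF lin] inner_commute)
    also have "\<dots> = u \<bullet> hom_res L h w" by (simp add: u_def inner_parts[of _ "hom_res L h w"])
    finally show ?thesis by (simp add: inner_hom_res)
  qed
  then have "y = (u v* L, - (u \<bullet> h))" by (rule vector_eq_rdot[THEN iffD1, rule_format])
  then have "(R - u) v* L = s *\<^sub>R x" "(R - u) \<bullet> h = - s"
    by (auto simp: y_def prod_eq_iff algebra_simps inner_diff_left)
  moreover have "bottom_part (R - u) = bottom_part (L *v x - h)"
    by (simp add: R_def u_def hom_res_def parts_simps)
  ultimately show thesis using that by blast
qed

text \<open>
  The Karush--Kuhn--Tucker equations of the homogeneous problem at \<open>(x, 1)\<close>, with \<open>s\<close> the minimal value and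
  \<open>t\<close> joining the negated multiplier of the constraint to the residual.
\<close>

definition is_tlse_multiplier ::
    "real^'n^('p::finite + 'q::finite) \<Rightarrow> real^('p + 'q) \<Rightarrow> real^'n \<Rightarrow> real \<Rightarrow> real^('p + 'q) \<Rightarrow> bool" where
  "is_tlse_multiplier L h x s t \<longleftrightarrow> top_part (L *v x - h) = 0 \<and>
     t v* L = s *\<^sub>R x \<and> t \<bullet> h = - s \<and> bottom_part t = bottom_part (L *v x - h)"

lemma multiplier_inner_residual:
  assumes "is_tlse_multiplier L h x s t" "is_tlse_multiplier L' h' x' s' t'"
  shows "t' \<bullet> (L *v x - h) = bottom_part t' \<bullet> bottom_part t" "t' \<bullet> (L' *v y - h') = s' * (1 + x' \<bullet> y)"
  unfolding inner_parts[of t' "L *v x - h"]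
  using assms by (simp_all add: is_tlse_multiplier_def inner_diff_right
      dot_lmul_matrix[symmetric] distrib_left)

text \<open>
  The two hypotheses on \<open>K\<close> and \<open>CA\<close> are what the formulas for \<open>\<K>\<close> and \<open>C\<^sub>A\<^sup>\<dagger>\<close> are made for: \<open>K\<close> kills the range of
  \<open>C\<^sup>T\<close>, which eliminates the multiplier of the constraint, and together they invert \<open>v \<mapsto> (A\<^sup>T A v - s v, C v)\<close>
  modulo that range. The formula for \<open>s' - s\<close> comes from pairing the equations of each problem with the
  solution of the other; the products of the two residuals cancel.
\<close>

lemma tlse_exact_difference:
  fixes L L' :: "real^'n^('p::finite + 'q::finite)"
  assumes base: "is_tlse_multiplier L h x s t" and pert: "is_tlse_multiplier L' h' x' s' t'"
    and K: "\<And>m. K *v (m v* top_part L) = 0"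
    and resolvent: "\<And>v. v = K *v ((bottom_part L *v v) v* bottom_part L - s *\<^sub>R v) + CA *v (top_part L *v v)"
  shows "x' - x = (s' - s) *\<^sub>R (K *v x') - K *v (t' v* (L' - L))
      - hcat CA (K ** transpose (bottom_part L)) *v ((L' - L) *v x' - (h' - h))"
    and "(s' - s) * (1 + x \<bullet> x') = t' \<bullet> ((L' - L) *v x - (h' - h)) + t \<bullet> ((L' - L) *v x' - (h' - h))"
proof -
  define A where "A = bottom_part L"
  define w where "w = (L' - L) *v x' - (h' - h)"
  define v where "v = x' - x"
  have "L *v v = (L' *v x' - h') - (L *v x - h) - w" by (simp add: w_def v_def algebra_simps)
  then have Cv: "top_part L *v v = - top_part w"
    and Av: "A *v v = bottom_part t' - bottom_part t - bottom_part w"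
    using base pert unfolding parts_mult[symmetric] A_def is_tlse_multiplier_def by (simp_all add: parts_simps)
  have adj: "K *v (bottom_part u v* A) = K *v (u v* L)" for u
    using K[of "top_part u"] by (simp add: vector_mult_parts[of u L] A_def algebra_simps)
  have "K *v (bottom_part t' v* A) = K *v (t' v* L' - t' v* (L' - L))"
    by (simp add: adj algebra_simps)
  also have "\<dots> = s' *\<^sub>R (K *v x') - K *v (t' v* (L' - L))"
    using pert by (simp add: is_tlse_multiplier_def algebra_simps)
  finally have t': "K *v (bottom_part t' v* A) = s' *\<^sub>R (K *v x') - K *v (t' v* (L' - L))" .
  have t: "K *v (bottom_part t v* A) = s *\<^sub>R (K *v x)"
    unfolding adj using base by (simp add: is_tlse_multiplier_def matrix_vector_mult_scaleR)
  have "v = K *v ((A *v v) v* A) - s *\<^sub>R (K *v v) + CA *v (top_part L *v v)"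
    using resolvent[of v] by (simp add: A_def algebra_simps)
  also have "\<dots> = (K *v (bottom_part t' v* A) - K *v (bottom_part t v* A) - K *v (bottom_part w v* A))
      - s *\<^sub>R (K *v v) - CA *v top_part w"
    unfolding Cv Av by (simp add: algebra_simps linear_neg[OF matrix_vector_mul_linear])
  also have "\<dots> = (s' - s) *\<^sub>R (K *v x') - K *v (t' v* (L' - L)) - (CA *v top_part w + K *v (bottom_part w v* A))"
    unfolding t t' by (simp add: v_def algebra_simps)
  also have "CA *v top_part w + K *v (bottom_part w v* A) = hcat CA (K ** transpose A) *v w"
    by (simp add: hcat_mult matrix_vector_mul_assoc[symmetric])
  finally show "x' - x = (s' - s) *\<^sub>R (K *v x') - K *v (t' v* (L' - L))
      - hcat CA (K ** transpose (bottom_part L)) *v ((L' - L) *v x' - (h' - h))"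
    by (simp add: v_def w_def A_def)
  have "s' * (1 + x' \<bullet> x) = bottom_part t' \<bullet> bottom_part t + t' \<bullet> ((L' - L) *v x - (h' - h))"
    using multiplier_inner_residual(1)[OF base pert] multiplier_inner_residual(2)[OF base pert, of x]
    by (simp add: inner_diff_right inner_add_right algebra_simps)
  moreover have "s * (1 + x \<bullet> x') = bottom_part t \<bullet> bottom_part t' - t \<bullet> ((L' - L) *v x' - (h' - h))"
    using multiplier_inner_residual(1)[OF pert base] multiplier_inner_residual(2)[OF pert base, of x']
    by (simp add: inner_diff_right inner_add_right algebra_simps)
  ultimately show "(s' - s) * (1 + x \<bullet> x') = t' \<bullet> ((L' - L) *v x - (h' - h)) + t \<bullet> ((L' - L) *v x' - (h' - h))"
    by (simp add: inner_commute algebra_simps)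
qed

lemma tendsto_vcat [tendsto_intros]:
  assumes "(u \<longlongrightarrow> u0) F" "(v \<longlongrightarrow> v0) F"
  shows "((\<lambda>k. vcat (u k) (v k)) \<longlongrightarrow> vcat u0 v0) F"
proof (rule vec_tendstoI)
  fix i show "((\<lambda>k. vcat (u k) (v k) $ i) \<longlongrightarrow> vcat u0 v0 $ i) F"
    using tendsto_vec_nth[OF assms(1)] tendsto_vec_nth[OF assms(2)] by (cases i) simp_all
qed

text \<open>
  The bottom block of a multiplier is the residual and \<open>s\<close> is a function of the residual and of \<open>x\<close>, so both
  converge with \<open>x\<close>. The top block \<open>m\<close> solves \<open>C\<^sup>T m = s x - A\<^sup>T r\<close>, whose right-hand side converges, and
  \<open>C\<^sup>T\<close> is bounded below uniformly near the given data.
\<close>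

lemma multiplier_tendsto:
  fixes L :: "real^'n^('p::finite + 'q::finite)"
  assumes c: "c > 0" "\<And>m. c * norm m \<le> norm (m v* top_part L)"
    and L: "(Lk \<longlongrightarrow> L) F" and h: "(hk \<longlongrightarrow> h) F" and x: "(xk \<longlongrightarrow> x) F"
    and pert: "\<forall>\<^sub>F k in F. is_tlse_multiplier (Lk k) (hk k) (xk k) (sk k) (tk k)"
    and base: "is_tlse_multiplier L h x s t"
  shows "(tk \<longlongrightarrow> t) F"
proof -
  \<comment> \<open>the multiplier equations determine \<open>s\<close> as the value of the quotient\<close>
  have s_eq: "s = (norm (bottom_part (L *v x - h)))\<^sup>2 / (1 + x \<bullet> x)" if "is_tlse_multiplier L h x s t"
    for L :: "real^'n^('p + 'q)" and h x s t
  proof -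
    have "1 + x \<bullet> x > 0" by (simp add: add_pos_nonneg)
    moreover have "s * (1 + x \<bullet> x) = (norm (bottom_part (L *v x - h)))\<^sup>2"
      using multiplier_inner_residual[OF that that] that
      by (simp add: is_tlse_multiplier_def power2_norm_eq_inner)
    ultimately show ?thesis by (simp add: field_simps)
  qed
  define R where "R k = bottom_part (Lk k *v xk k - hk k)" for k
  define S where "S k = (norm (R k))\<^sup>2 / (1 + xk k \<bullet> xk k)" for k
  have "(R \<longlongrightarrow> bottom_part (L *v x - h)) F"
    unfolding R_def by (intro tendsto_intros L h x)
  moreover have bt: "bottom_part t = bottom_part (L *v x - h)"
    using base by (simp add: is_tlse_multiplier_def)
  ultimately have R: "(R \<longlongrightarrow> bottom_part t) F" by simp
  have "1 + x \<bullet> x \<noteq> 0" by (metis add_pos_nonneg inner_ge_zero less_irrefl zero_less_one)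
  then have S: "(S \<longlongrightarrow> s) F"
    unfolding S_def s_eq[OF base] bt[symmetric] by (intro tendsto_intros R x)
  have top: "top_part u v* top_part M = u v* M - bottom_part u v* bottom_part M"
    for u and M :: "real^'n^('p + 'q)"
    by (simp add: vector_mult_parts[of u M])
  \<comment> \<open>\<open>G k\<close> is \<open>(m\<^sub>k - m) C\<^sub>k\<close>, \<open>m\<^sub>k\<close> and \<open>m\<close> being the top blocks of \<open>tk k\<close> and \<open>t\<close>\<close>
  define G where "G k = (S k *\<^sub>R xk k - R k v* bottom_part (Lk k)) - top_part t v* top_part (Lk k)" for k
  have "(G \<longlongrightarrow> (s *\<^sub>R x - bottom_part t v* bottom_part L) - top_part t v* top_part L) F"
    unfolding G_def by (intro tendsto_intros L h x R S)
  then have "(G \<longlongrightarrow> 0) F"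
    using base by (simp add: top is_tlse_multiplier_def)
  then have G: "((\<lambda>k. 2 / c * norm (G k)) \<longlongrightarrow> 0) F"
    using tendsto_mult_right_zero tendsto_norm_zero by blast
  have "((\<lambda>k. norm (top_part (Lk k) - top_part L)) \<longlongrightarrow> norm (top_part L - top_part L)) F"
    by (intro tendsto_intros L)
  then have near: "\<forall>\<^sub>F k in F. norm (top_part (Lk k) - top_part L) < c / 2"
    using c(1) by (intro order_tendstoD(2)) auto
  have "\<forall>\<^sub>F k in F. norm (top_part (tk k) - top_part t) \<le> 2 / c * norm (G k)"
    using near pert
  proof eventually_elim
    case (elim k)
    have "S k = sk k" "R k = bottom_part (tk k)"
      using s_eq[OF elim(2)] elim(2) by (auto simp: S_def R_def is_tlse_multiplier_def)
    then have "(top_part (tk k) - top_part t) v* top_part (Lk k) = G k"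
      using elim(2) by (simp add: G_def top is_tlse_multiplier_def vector_matrix_mult_diff_distrib)
    then have "c / 2 * norm (top_part (tk k) - top_part t) \<le> norm (G k)"
      using lower_bound_perturbed[OF c(2), of "top_part (Lk k)" "top_part (tk k) - top_part t"] elim(1) by simp
    then show ?case using c(1) by (simp add: field_simps)
  qed
  from Lim_null_comparison[OF this G] have "((\<lambda>k. top_part (tk k)) \<longlongrightarrow> top_part t) F"
    by (rule Lim_null[THEN iffD2])
  from tendsto_vcat[OF this R] have lim: "((\<lambda>k. vcat (top_part (tk k)) (R k)) \<longlongrightarrow> t) F"
    by (simp add: vcat_parts)
  show ?thesis
  proof (rule Lim_transform_eventually[OF lim])
    show "\<forall>\<^sub>F k in F. vcat (top_part (tk k)) (R k) = tk k"
      using pert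
    proof eventually_elim
      case (elim k)
      then have "R k = bottom_part (tk k)" by (simp add: R_def is_tlse_multiplier_def)
      then show ?case by (simp add: vcat_parts)
    qed
  qed
qed

text \<open>
  In the exact difference formula the perturbed quantities \<open>x'\<close> and \<open>t'\<close> may be replaced by \<open>x\<close> and \<open>t\<close> at the cost
  of an error bounded by \<open>g\<close> times the size of the perturbation, where \<open>g\<close> tends to \<open>0\<close> because \<open>x'\<close> and \<open>t'\<close> are
  continuous at the given data.
\<close>

lemma tlse_map_has_derivative:
  fixes L :: "real^'n^('p::finite + 'q::finite)"
  assumes pn: "CARD('p) \<le> CARD('n)"
    and c: "c > 0" "\<And>m. c * norm m \<le> norm (m v* top_part L)"
    and no_horizontal: "\<And>s w. hom_minimiser L h s w \<Longrightarrow> snd w = 0 \<Longrightarrow> w = 0"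
    and x: "x = tlse_map L h"
    and base: "is_tlse_multiplier L h x s t"
    and K: "\<And>m. K *v (m v* top_part L) = 0"
    and resolvent: "\<And>v. v = K *v ((bottom_part L *v v) v* bottom_part L - s *\<^sub>R v) + CA *v (top_part L *v v)"
    and H1: "H1 = (2 / (1 + (norm x)\<^sup>2)) *\<^sub>R outer (K *v x) t - hcat CA (K ** transpose (bottom_part L))"
  shows "((\<lambda>D. tlse_map (fst D) (snd D)) has_derivative
      (\<lambda>D. H1 *v (fst D *v x - snd D) - K *v (t v* fst D))) (at (L, h))"
proof -
  define \<phi> where "\<phi> D = tlse_map (fst D) (snd D)" for D :: "(real^'n^('p + 'q)) \<times> (real^('p + 'q))"
  define P where "P = hcat CA (K ** transpose (bottom_part L))"
  define T where "T D = H1 *v (fst D *v x - snd D) - K *v (t v* fst D)" for D :: "(real^'n^('p + 'q)) \<times> (real^('p + 'q))"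
  define mult where "mult D = (SOME st. is_tlse_multiplier (fst D) (snd D) (\<phi> D) (fst st) (snd st))" for D
  define \<sigma> \<tau> where "\<sigma> D = fst (mult D)" and "\<tau> D = snd (mult D)" for D
  have stable: "\<forall>\<^sub>F D in nhds (L, h).
      (\<exists>s. hom_minimiser (fst D) (snd D) s (\<phi> D, 1)) \<and> dist (\<phi> D) x < e" if "e > 0" for e
    unfolding \<phi>_def x by (rule tlse_map_stable[OF pn c _ that]) (use no_horizontal in blast)
  have "\<forall>\<^sub>F D in nhds (L, h). \<exists>s. hom_minimiser (fst D) (snd D) s (\<phi> D, 1)"
    using stable[OF zero_less_one] by eventually_elim simp
  then have mult: "\<forall>\<^sub>F D in nhds (L, h). is_tlse_multiplier (fst D) (snd D) (\<phi> D) (\<sigma> D) (\<tau> D)"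
  proof eventually_elim
    case (elim D)
    then obtain s' where s': "hom_minimiser (fst D) (snd D) s' (\<phi> D, 1)" by blast
    obtain t' where "t' v* fst D = s' *\<^sub>R \<phi> D" "t' \<bullet> snd D = - s'"
      "bottom_part t' = bottom_part (fst D *v \<phi> D - snd D)" using tlse_multiplier[OF s'] by blast
    then have "is_tlse_multiplier (fst D) (snd D) (\<phi> D) (fst (s', t')) (snd (s', t'))"
      using s' by (simp add: is_tlse_multiplier_def hom_minimiser_def affine_feasible_iff parts_simps parts_mult)
    from someI[of "\<lambda>st. is_tlse_multiplier (fst D) (snd D) (\<phi> D) (fst st) (snd st)", OF this]
    show ?case by (simp add: mult_def \<sigma>_def \<tau>_def)
  qed
  have id: "((\<lambda>D. D) \<longlongrightarrow> (L, h)) (nhds (L, h))" by (simp add: filterlim_ident)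
  have L: "(fst \<longlongrightarrow> L) (nhds (L, h))" and h: "(snd \<longlongrightarrow> h) (nhds (L, h))"
    using tendsto_fst[OF id] tendsto_snd[OF id] by simp_all
  have \<phi>: "(\<phi> \<longlongrightarrow> x) (nhds (L, h))"
    by (rule tendstoI, drule stable) (auto elim: eventually_mono)
  have \<tau>: "(\<tau> \<longlongrightarrow> t) (nhds (L, h))"
    by (rule multiplier_tendsto[OF c L h \<phi> mult base])
  define y where "y u = (1 / (1 + x \<bullet> u)) *\<^sub>R (K *v u)" for u
  define N where "N = norm x + 1"
  define g where "g D = norm P * norm (\<phi> D - x) + norm K * norm (\<tau> D - t)
      + ((norm (\<tau> D - t) * N + norm t * norm (\<phi> D - x)) * norm (y (\<phi> D))
        + 2 * (norm t * N) * norm (y (\<phi> D) - y x))" for D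
  have ne: "1 + x \<bullet> x \<noteq> 0" by (metis add_pos_nonneg inner_ge_zero less_irrefl zero_less_one)
  have y: "((\<lambda>D. y (\<phi> D)) \<longlongrightarrow> y x) (nhds (L, h))"
    unfolding y_def by (intro tendsto_intros \<phi> ne)
  have "(g \<longlongrightarrow> norm P * norm (x - x) + norm K * norm (t - t)
      + ((norm (t - t) * N + norm t * norm (x - x)) * norm (y x)
        + 2 * (norm t * N) * norm (y x - y x))) (nhds (L, h))"
    unfolding g_def by (intro tendsto_intros \<phi> \<tau> y)
  then have g: "(g \<longlongrightarrow> 0) (nhds (L, h))" by simp
  have "((\<lambda>D. 1 + x \<bullet> \<phi> D) \<longlongrightarrow> 1 + x \<bullet> x) (nhds (L, h))" by (intro tendsto_intros \<phi>)
  from tendsto_imp_eventually_ne[OF this ne]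
  have est: "\<forall>\<^sub>F D in nhds (L, h). norm (\<phi> D - \<phi> (L, h) - T (D - (L, h))) \<le> g D * norm (D - (L, h))"
    using mult
  proof eventually_elim
    case (elim D)
    define M e where "M = fst D - L" and "e = snd D - h"
    define x' t' where "x' = \<phi> D" and "t' = \<tau> D"
    define w where "w = M *v x - e"
    have diff: "x' - x = (\<sigma> D - s) *\<^sub>R (K *v x') - K *v (t' v* M) - P *v (M *v x' - e)"
      and s: "(\<sigma> D - s) * (1 + x \<bullet> x') = t' \<bullet> w + t \<bullet> (M *v x' - e)"
      using tlse_exact_difference[OF base elim(2) K resolvent]
      by (simp_all add: P_def M_def e_def x'_def t'_def w_def)
    have "(\<sigma> D - s) *\<^sub>R (K *v x') = (t' \<bullet> w + t \<bullet> (M *v x' - e)) *\<^sub>R y x'"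
      unfolding s[symmetric] using elim(1) by (simp add: y_def x'_def)
    also have "t' \<bullet> w + t \<bullet> (M *v x' - e) = 2 * (t \<bullet> w) + ((t' - t) \<bullet> w + t \<bullet> (M *v (x' - x)))"
      by (simp add: w_def algebra_simps inner_diff_left inner_diff_right)
    finally have s_term: "(\<sigma> D - s) *\<^sub>R (K *v x')
      = (2 * (t \<bullet> w) + ((t' - t) \<bullet> w + t \<bullet> (M *v (x' - x)))) *\<^sub>R y x'" .
    have Teq: "T (D - (L, h)) = (2 * (t \<bullet> w)) *\<^sub>R y x - P *v w - K *v (t v* M)"
      by (simp add: T_def H1 P_def M_def e_def w_def y_def matrix_vector_mult_diff_rdistrib scaleR_mult
          outer_mult power2_norm_eq_inner mult.commute)
    have eq: "x' - x - T (D - (L, h)) = ((t' - t) \<bullet> w + t \<bullet> (M *v (x' - x))) *\<^sub>R y x'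
        + (2 * (t \<bullet> w)) *\<^sub>R (y x' - y x) - K *v ((t' - t) v* M) - P *v (M *v (x' - x))"
    proof -
      define b where "b = (t' - t) \<bullet> w + t \<bullet> (M *v (x' - x))"
      have x'_diff: "x' - x = (2 * (t \<bullet> w) + b) *\<^sub>R y x' - K *v (t' v* M) - P *v (M *v x' - e)"
        using diff s_term by (simp only: b_def)
      have "x' - x - T (D - (L, h)) = ((2 * (t \<bullet> w) + b) *\<^sub>R y x' - K *v (t' v* M) - P *v (M *v x' - e))
          - ((2 * (t \<bullet> w)) *\<^sub>R y x - P *v w - K *v (t v* M))"
        by (simp only: x'_diff Teq)
      also have "\<dots> = b *\<^sub>R y x' + (2 * (t \<bullet> w)) *\<^sub>R (y x' - y x)
          - (K *v (t' v* M) - K *v (t v* M)) - (P *v (M *v x' - e) - P *v w)"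
        by (simp add: scaleR_add_left scaleR_diff_right)
      also have "K *v (t' v* M) - K *v (t v* M) = K *v ((t' - t) v* M)"
        by (simp only: vector_matrix_mult_diff_distrib matrix_vector_mult_diff_distrib)
      also have "P *v (M *v x' - e) - P *v w = P *v (M *v (x' - x))"
        by (simp add: w_def matrix_vector_mult_diff_distrib)
      finally show ?thesis by (simp only: b_def)
    qed
    define d where "d = norm (D - (L, h))"
    have M: "norm M \<le> d" and e: "norm e \<le> d"
    proof -
      have "D - (L, h) = (M, e)" by (simp add: prod_eq_iff M_def e_def)
      then show "norm M \<le> d" "norm e \<le> d"
        by (simp_all only: d_def norm_fst_le norm_snd_le)
    qed
    have w: "norm w \<le> N * d"
    proof -
      have "norm w \<le> norm M * norm x + norm e"
        using norm_triangle_ineq4[of "M *v x" e] norm_matrix_vector_le[of M x] by (simp add: w_def)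
      also have "\<dots> \<le> d * norm x + d" using M e by (intro add_mono mult_right_mono) auto
      finally show ?thesis by (simp add: N_def algebra_simps)
    qed
    have Mx: "norm (M *v (x' - x)) \<le> d * norm (x' - x)"
      using norm_matrix_vector_le[of M "x' - x"] M by (meson mult_right_mono norm_ge_zero order_trans)
    have 1: "norm (((t' - t) \<bullet> w + t \<bullet> (M *v (x' - x))) *\<^sub>R y x')
        \<le> (norm (t' - t) * (N * d) + norm t * (d * norm (x' - x))) * norm (y x')"
    proof -
      have "\<bar>(t' - t) \<bullet> w\<bar> \<le> norm (t' - t) * (N * d)"
        using Cauchy_Schwarz_ineq2[of "t' - t" w] w by (meson mult_left_mono norm_ge_zero order_trans)
      moreover have "\<bar>t \<bullet> (M *v (x' - x))\<bar> \<le> norm t * (d * norm (x' - x))"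
        using Cauchy_Schwarz_ineq2[of t "M *v (x' - x)"] Mx by (meson mult_left_mono norm_ge_zero order_trans)
      ultimately show ?thesis unfolding norm_scaleR by (intro mult_right_mono) auto
    qed
    have 2: "norm ((2 * (t \<bullet> w)) *\<^sub>R (y x' - y x)) \<le> 2 * (norm t * (N * d)) * norm (y x' - y x)"
    proof -
      have "\<bar>t \<bullet> w\<bar> \<le> norm t * (N * d)"
        using Cauchy_Schwarz_ineq2[of t w] w by (meson mult_left_mono norm_ge_zero order_trans)
      then show ?thesis unfolding norm_scaleR abs_mult by (intro mult_right_mono) auto
    qed
    have 3: "norm (K *v ((t' - t) v* M)) \<le> norm K * (d * norm (t' - t))"
      using norm_matrix_vector_le[of K "(t' - t) v* M"] norm_vector_matrix_le[of "t' - t" M] M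
      by (meson mult_left_mono mult_right_mono norm_ge_zero order_trans)
    have 4: "norm (P *v (M *v (x' - x))) \<le> norm P * (d * norm (x' - x))"
      using norm_matrix_vector_le[of P "M *v (x' - x)"] Mx
      by (meson mult_left_mono norm_ge_zero order_trans)
    have "norm (x' - x - T (D - (L, h))) \<le> (norm (t' - t) * (N * d) + norm t * (d * norm (x' - x))) * norm (y x')
        + 2 * (norm t * (N * d)) * norm (y x' - y x) + norm K * (d * norm (t' - t)) + norm P * (d * norm (x' - x))"
    proof -
      have "norm (a + b - k - p) \<le> r1 + r2 + r3 + r4"
        if "norm a \<le> r1" "norm b \<le> r2" "norm k \<le> r3" "norm p \<le> r4"
        for a b k p :: "real^'n" and r1 r2 r3 r4
        using that by norm
      from this[OF 1 2 3 4] show ?thesis unfolding eq .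
    qed
    also have "\<dots> = g D * d"
      by (simp add: g_def x'_def t'_def algebra_simps)
    finally show ?case by (simp add: x'_def d_def x \<phi>_def)
  qed
  have "bounded_linear T"
  proof -
    have "t v* (a *\<^sub>R M) = a *\<^sub>R (t v* M)" for a and M :: "real^'n^('p + 'q)"
      by (simp add: vec_eq_iff vector_matrix_mult_def sum_distrib_left mult_ac)
    then have "linear T"
      by (intro linearI) (simp_all add: T_def matrix_vector_mult_add_rdistrib scaleR_mult
          matrix_vector_right_distrib vector_matrix_mult_add_rdistrib matrix_vector_mult_scaleR
          matrix_vector_mult_diff_distrib scaleR_diff_right)
    then show ?thesis by (simp add: linear_conv_bounded_linear)
  qed
  moreover have "\<exists>d>0. \<forall>D. norm (D - (L, h)) < d \<longrightarrow>
      norm (\<phi> D - \<phi> (L, h) - T (D - (L, h))) \<le> \<epsilon> * norm (D - (L, h))" if "\<epsilon> > 0" for \<epsilon>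
  proof -
    have "\<forall>\<^sub>F D in nhds (L, h). g D < \<epsilon>" using g that by (rule order_tendstoD(2))
    with est have "\<forall>\<^sub>F D in nhds (L, h). norm (\<phi> D - \<phi> (L, h) - T (D - (L, h))) \<le> \<epsilon> * norm (D - (L, h))"
      by eventually_elim (meson less_imp_le mult_right_mono norm_ge_zero order_trans)
    then show ?thesis unfolding eventually_nhds_metric by (auto simp: dist_norm)
  qed
  ultimately have "(\<phi> has_derivative T) (at (L, h))" unfolding has_derivative_at_alt by blast
  then show ?thesis by (simp add: \<phi>_def[abs_def] T_def[abs_def])
qed

section \<open>From the derivative to the limit of the suprema\<close>

lemma flex_norm_Pair: "flex_norm \<alpha> \<beta> E f = norm (\<alpha> *\<^sub>R E, \<beta> *\<^sub>R f)"
  by (simp add: flex_norm_def norm_Pair power_mult_distrib)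

lemma flex_norm_nonneg: "flex_norm \<alpha> \<beta> E f \<ge> 0"
  by (simp add: flex_norm_Pair)

lemma flex_norm_scale: "flex_norm \<alpha> \<beta> (a *\<^sub>R E) (a *\<^sub>R f) = \<bar>a\<bar> * flex_norm \<alpha> \<beta> E f"
proof -
  have "(\<alpha> *\<^sub>R a *\<^sub>R E, \<beta> *\<^sub>R a *\<^sub>R f) = a *\<^sub>R (\<alpha> *\<^sub>R E, \<beta> *\<^sub>R f)" by (simp add: mult.commute)
  then show ?thesis unfolding flex_norm_Pair by (simp only: norm_scaleR)
qed

lemma norm_le_flex_norm:
  assumes "\<alpha> > 0" "\<beta> > 0"
  shows "min \<alpha> \<beta> * norm (E, f) \<le> flex_norm \<alpha> \<beta> E f"
proof (rule power2_le_imp_le)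
  let ?c = "min \<alpha> \<beta>"
  have "?c\<^sup>2 \<le> \<alpha>\<^sup>2" "?c\<^sup>2 \<le> \<beta>\<^sup>2" using assms by (auto intro!: power_mono)
  then have "?c\<^sup>2 * (norm E)\<^sup>2 + ?c\<^sup>2 * (norm f)\<^sup>2 \<le> \<alpha>\<^sup>2 * (norm E)\<^sup>2 + \<beta>\<^sup>2 * (norm f)\<^sup>2"
    by (intro add_mono mult_right_mono) auto
  then show "(?c * norm (E, f))\<^sup>2 \<le> (flex_norm \<alpha> \<beta> E f)\<^sup>2"
    by (simp add: flex_norm_def norm_Pair power_mult_distrib distrib_left)
qed (rule flex_norm_nonneg)

text \<open>
  The hypotheses \<open>upper\<close> and \<open>sharp\<close> say that \<open>\<kappa>\<close> is the operator norm of the derivative for the flexible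
  norm. On the ball of radius \<open>\<eta>\<close> times the norm of the data, the increment differs from the derivative by
  \<open>o(\<eta>)\<close> uniformly. A nearly optimal direction, scaled to that radius, gives the lower bound.
\<close>

lemma cond_quotient_sup_tendsto:
  fixes \<phi> :: "real^'n^'m \<Rightarrow> real^'m \<Rightarrow> real^'k"
  assumes der: "((\<lambda>D. \<phi> (fst D) (snd D)) has_derivative T) (at (L, h))"
    and \<alpha>: "\<alpha> > 0" and \<beta>: "\<beta> > 0" and X: "\<phi> L h \<noteq> 0" and N0: "flex_norm \<alpha> \<beta> L h > 0"
    and upper: "\<And>D. norm (T D) \<le> \<kappa> * flex_norm \<alpha> \<beta> (fst D) (snd D)"
    and sharp: "\<And>\<kappa>'. \<kappa>' < \<kappa> \<Longrightarrow> \<exists>D. \<kappa>' * flex_norm \<alpha> \<beta> (fst D) (snd D) < norm (T D)"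
  shows "(cond_quotient_sup \<phi> \<alpha> \<beta> L h \<longlongrightarrow> ereal (\<kappa> * (flex_norm \<alpha> \<beta> L h / norm (\<phi> L h)))) (at_right 0)"
proof -
  define N where "N D = flex_norm \<alpha> \<beta> (fst D) (snd D)" for D :: "(real^'n^'m) \<times> (real^'m)"
  define N0 where "N0 = flex_norm \<alpha> \<beta> L h"
  define X where "X = norm (\<phi> L h)"
  define c where "c = min \<alpha> \<beta>"
  define F where "F D = \<phi> (L + fst D) (h + snd D) - \<phi> L h" for D
  have pos: "N0 > 0" "X > 0" "c > 0" using assms by (simp_all add: N0_def X_def c_def)
  have cN: "norm D \<le> N D / c" for D
    using norm_le_flex_norm[OF \<alpha> \<beta>, of "fst D" "snd D"] pos(3) by (simp add: N_def c_def field_simps)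
  have linT: "linear T" using der by (simp add: has_derivative_def bounded_linear.linear)
  have approx: "\<exists>d>0. \<forall>\<eta>>0. \<eta> < d \<longrightarrow> (\<forall>D. N D \<le> \<eta> * N0 \<longrightarrow> norm (F D - T D) \<le> e * (\<eta> * N0))" if "e > 0" for e
  proof -
    have "e * c > 0" using that pos by simp
    then obtain d where d: "d > 0" "\<And>D. norm (D - (L, h)) < d \<Longrightarrow>
        norm (\<phi> (fst D) (snd D) - \<phi> L h - T (D - (L, h))) \<le> e * c * norm (D - (L, h))"
      using der unfolding has_derivative_at_alt by (auto simp del: fst_diff snd_diff)
    have "norm (F D - T D) \<le> e * (\<eta> * N0)" if "\<eta> > 0" "\<eta> < d * c / N0" "N D \<le> \<eta> * N0" for \<eta> D
    proof -
      have "norm D \<le> \<eta> * N0 / c" using cN[of D] that(3) pos(3) by (meson divide_right_mono less_imp_le order_trans)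
      moreover have "\<eta> * N0 / c < d" using that(2) pos by (simp add: field_simps)
      ultimately have "norm (((L, h) + D) - (L, h)) < d" by simp
      from d(2)[OF this] have "norm (F D - T D) \<le> e * c * norm D" by (simp add: F_def)
      also have "\<dots> \<le> e * c * (\<eta> * N0 / c)"
        using \<open>norm D \<le> \<eta> * N0 / c\<close> \<open>e * c > 0\<close> by (intro mult_left_mono) auto
      also have "\<dots> = e * (\<eta> * N0)" using pos by simp
      finally show ?thesis .
    qed
    then show ?thesis using d(1) pos by (intro exI[of _ "d * c / N0"]) auto
  qed
  have sup: "cond_quotient_sup \<phi> \<alpha> \<beta> L h \<eta> = (SUP D\<in>{D. N D \<le> \<eta> * N0}. ereal (norm (F D) / (\<eta> * X)))" for \<eta>
    unfolding cond_quotient_sup_def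
    by (rule arg_cong[where f = Sup]) (auto simp: F_def N_def N0_def X_def image_def)
  show ?thesis unfolding N0_def[symmetric] X_def[symmetric]
  proof (rule order_tendstoI)
    fix a assume "a < ereal (\<kappa> * (N0 / X))"
    then obtain r where r: "a < ereal r" "r < \<kappa> * (N0 / X)" using ereal_dense2 by force
    define \<kappa>' where "\<kappa>' = r * X / N0"
    have "\<kappa>' < \<kappa>" using r(2) pos by (simp add: \<kappa>'_def field_simps)
    then obtain \<kappa>1 where \<kappa>1: "\<kappa>' < \<kappa>1" "\<kappa>1 < \<kappa>" using dense by blast
    obtain D where D: "\<kappa>1 * N D < norm (T D)" using sharp[OF \<kappa>1(2)] by (auto simp: N_def)
    have "D \<noteq> 0"
    proof
      assume "D = 0"
      then show False using D linear_0[OF linT] by (simp add: N_def flex_norm_def)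
    qed
    then have ND: "N D > 0" using cN[of D] pos(3) zero_less_norm_iff[of D]
      by (metis less_le_trans zero_less_divide_iff not_less_iff_gr_or_eq)
    obtain d where d: "d > 0" "\<And>\<eta> D. \<eta> > 0 \<Longrightarrow> \<eta> < d \<Longrightarrow> N D \<le> \<eta> * N0 \<Longrightarrow>
        norm (F D - T D) \<le> (\<kappa>1 - \<kappa>') * (\<eta> * N0)"
      using approx[of "\<kappa>1 - \<kappa>'"] \<kappa>1 by auto
    have "a < cond_quotient_sup \<phi> \<alpha> \<beta> L h \<eta>" if \<eta>: "\<eta> > 0" "\<eta> < d" for \<eta>
    proof -
      define s where "s = \<eta> * N0 / N D"
      have s: "s > 0" using \<eta> pos ND by (simp add: s_def)
      have NsD: "N (s *\<^sub>R D) = \<eta> * N0"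
        using s ND by (simp add: N_def flex_norm_scale) (simp add: s_def N_def)
      have "\<kappa>1 * (\<eta> * N0) < norm (T (s *\<^sub>R D))"
      proof -
        have "s * (\<kappa>1 * N D) = \<kappa>1 * (\<eta> * N0)" using ND by (simp add: s_def)
        moreover have "norm (T (s *\<^sub>R D)) = s * norm (T D)" using s by (simp add: linear_scale[OF linT])
        ultimately show ?thesis using mult_strict_left_mono[OF D s] by (simp only:)
      qed
      moreover have "norm (T (s *\<^sub>R D)) \<le> norm (F (s *\<^sub>R D)) + norm (F (s *\<^sub>R D) - T (s *\<^sub>R D))"
        by norm
      ultimately have "\<kappa>' * (\<eta> * N0) < norm (F (s *\<^sub>R D))"
        using d(2)[OF \<eta>, of "s *\<^sub>R D"] NsD by (simp add: algebra_simps)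
      then have "ereal r < ereal (norm (F (s *\<^sub>R D)) / (\<eta> * X))"
        using pos \<eta> by (simp add: \<kappa>'_def field_simps)
      also have "ereal (norm (F (s *\<^sub>R D)) / (\<eta> * X)) \<le> cond_quotient_sup \<phi> \<alpha> \<beta> L h \<eta>"
        unfolding sup using NsD by (intro SUP_upper) simp
      finally show ?thesis using r(1) by simp
    qed
    then show "\<forall>\<^sub>F \<eta> in at_right 0. a < cond_quotient_sup \<phi> \<alpha> \<beta> L h \<eta>"
      unfolding eventually_at_right_field using d(1) by blast
  next
    fix a assume "ereal (\<kappa> * (N0 / X)) < a"
    then obtain r where r: "ereal r < a" "\<kappa> * (N0 / X) < r" using ereal_dense2 by force
    define \<kappa>' where "\<kappa>' = r * X / N0"
    have \<kappa>': "\<kappa> < \<kappa>'" using r(2) pos by (simp add: \<kappa>'_def field_simps)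
    have "0 \<le> \<kappa> * N0" using order_trans[OF norm_ge_zero upper[of "(L, h)"]] by (simp add: N0_def)
    then have \<kappa>0: "\<kappa> \<ge> 0" using pos(1) by (simp add: zero_le_mult_iff)
    obtain d where d: "d > 0" "\<And>\<eta> D. \<eta> > 0 \<Longrightarrow> \<eta> < d \<Longrightarrow> N D \<le> \<eta> * N0 \<Longrightarrow>
        norm (F D - T D) \<le> (\<kappa>' - \<kappa>) * (\<eta> * N0)"
      using approx[of "\<kappa>' - \<kappa>"] \<kappa>' by auto
    have "cond_quotient_sup \<phi> \<alpha> \<beta> L h \<eta> < a" if \<eta>: "\<eta> > 0" "\<eta> < d" for \<eta>
    proof -
      have "norm (F D) / (\<eta> * X) \<le> r" if D: "N D \<le> \<eta> * N0" for D
      proof -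
        have "norm (F D) \<le> norm (T D) + norm (F D - T D)" by norm
        also have "\<dots> \<le> \<kappa> * (\<eta> * N0) + (\<kappa>' - \<kappa>) * (\<eta> * N0)"
          using upper[of D] d(2)[OF \<eta> D] mult_left_mono[OF D \<kappa>0] by (intro add_mono) (simp_all add: N_def)
        also have "\<dots> = r * (\<eta> * X)" using pos by (simp add: \<kappa>'_def field_simps)
        finally show ?thesis using pos \<eta> by (simp add: field_simps)
      qed
      then have "cond_quotient_sup \<phi> \<alpha> \<beta> L h \<eta> \<le> ereal r"
        unfolding sup by (intro SUP_least) simp
      then show ?thesis using r(1) by simp
    qed
    then show "\<forall>\<^sub>F \<eta> in at_right 0. cond_quotient_sup \<phi> \<alpha> \<beta> L h \<eta> < a"
      unfolding eventually_at_right_field using d(1) by blast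
  qed
qed

section \<open>Spectral norms and the norm of the derivative\<close>

lemma norm_mult_le_spec: "norm (M *v v) \<le> spec_norm M * norm v" for M :: "real^'n^'m"
  unfolding spec_norm_def by (rule onorm) simp

lemma spec_norm_nonneg: "spec_norm M \<ge> 0" for M :: "real^'n^'m"
  unfolding spec_norm_def by (rule onorm_pos_le) simp

lemma spec_norm_le: "(\<And>v. norm (M *v v) \<le> B * norm v) \<Longrightarrow> spec_norm M \<le> B" for M :: "real^'n^'m"
  unfolding spec_norm_def by (rule onorm_le)

lemma norm_vec_mult_le_spec: "norm (v v* M) \<le> spec_norm M * norm v" for M :: "real^'n^'m"
proof -
  have "(norm (v v* M))\<^sup>2 = v \<bullet> (M *v (v v* M))" by (simp add: dot_lmul_matrix[symmetric] power2_norm_eq_inner)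
  also have "\<dots> \<le> norm v * norm (M *v (v v* M))" by (rule norm_cauchy_schwarz)
  also have "\<dots> \<le> norm v * (spec_norm M * norm (v v* M))"
    by (intro mult_left_mono norm_mult_le_spec) simp
  finally have "norm (v v* M) * norm (v v* M) \<le> (spec_norm M * norm v) * norm (v v* M)"
    by (simp add: power2_eq_square mult_ac)
  then show ?thesis
    using spec_norm_nonneg[of M] by (cases "v v* M = 0") auto
qed

lemma spec_norm_transpose: "spec_norm (transpose M) = spec_norm M" for M :: "real^'n^'m"
proof (rule antisym)
  show "spec_norm (transpose M) \<le> spec_norm M"
    using norm_vec_mult_le_spec[of _ M] by (intro spec_norm_le) simp
  show "spec_norm M \<le> spec_norm (transpose M)"
    using norm_vec_mult_le_spec[of _ "transpose M"] by (intro spec_norm_le) simp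
qed

lemma spec_norm_le_adjoint: "(\<And>v. norm (v v* M) \<le> B * norm v) \<Longrightarrow> spec_norm M \<le> B" for M :: "real^'n^'m"
  using spec_norm_le[of "transpose M" B] by (simp add: spec_norm_transpose)

lemma spec_norm_scaleR_le: "spec_norm (a *\<^sub>R M) \<le> \<bar>a\<bar> * spec_norm M" for M :: "real^'n^'m"
  using norm_mult_le_spec[of M] by (intro spec_norm_le) (simp add: scaleR_mult mult.assoc mult_left_mono)

lemma spec_norm_outer_le: "spec_norm (outer u v) \<le> norm u * norm v"
proof (rule spec_norm_le)
  fix w
  have "\<bar>v \<bullet> w\<bar> * norm u \<le> (norm v * norm w) * norm u"
    by (intro mult_right_mono Cauchy_Schwarz_ineq2) simp
  then show "norm (outer u v *v w) \<le> norm u * norm v * norm w" by (simp add: outer_mult mult_ac)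
qed

lemma spec_norm_diff_le: "spec_norm (M - N) \<le> spec_norm M + spec_norm N" for M N :: "real^'n^'m"
proof (rule spec_norm_le)
  fix v
  show "norm ((M - N) *v v) \<le> (spec_norm M + spec_norm N) * norm v"
    using norm_triangle_ineq4[of "M *v v" "N *v v"] norm_mult_le_spec[of M v] norm_mult_le_spec[of N v]
    by (simp add: matrix_vector_mult_diff_rdistrib distrib_right)
qed

lemma spec_norm_hcat_le: "spec_norm (hcat M N) \<le> spec_norm M + spec_norm N"
  for M :: "real^'n^'m" and N :: "real^'k^'m"
proof (rule spec_norm_le)
  fix v :: "real^('n + 'k)"
  have "norm (hcat M N *v v) \<le> spec_norm M * norm (top_part v) + spec_norm N * norm (bottom_part v)"
    using norm_triangle_ineq[of "M *v top_part v" "N *v bottom_part v"]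
      norm_mult_le_spec[of M "top_part v"] norm_mult_le_spec[of N "bottom_part v"]
    by (simp add: hcat_mult)
  also have "\<dots> \<le> spec_norm M * norm v + spec_norm N * norm v"
    by (intro add_mono mult_left_mono norm_part_le spec_norm_nonneg)
  finally show "norm (hcat M N *v v) \<le> (spec_norm M + spec_norm N) * norm v" by (simp add: distrib_right)
qed

text \<open>
  With respect to the inner product of the flexible norm, the adjoint of \<open>T\<close> maps \<open>v\<close> to the pair of
  \<open>E v / \<alpha>\<close> and \<open>f v / \<beta>\<close>, whose flexible norm is \<open>|M\<^sup>T v|\<close> by hypothesis. An operator and its adjoint have the
  same norm. For the second claim, the adjoint at a nearly optimal \<open>v\<close> is the required direction.
\<close>

lemma flex_operator_norm:
  fixes T :: "(real^'n^'m) \<times> (real^'m) \<Rightarrow> real^'k" and M :: "real^'j^'k"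
  assumes \<alpha>: "\<alpha> > 0" and \<beta>: "\<beta> > 0"
    and adj: "\<And>D v. T D \<bullet> v = \<alpha> * (fst D \<bullet> E v) + \<beta> * (snd D \<bullet> f v)"
    and M: "\<And>v. (norm (E v))\<^sup>2 + (norm (f v))\<^sup>2 = (norm (v v* M))\<^sup>2"
  shows "norm (T D) \<le> spec_norm M * flex_norm \<alpha> \<beta> (fst D) (snd D)"
    and "\<kappa>' < spec_norm M \<Longrightarrow> \<exists>D. \<kappa>' * flex_norm \<alpha> \<beta> (fst D) (snd D) < norm (T D)"
proof -
  have EM: "norm (E v, f v) = norm (v v* M)" for v
    using M[of v] by (simp add: norm_Pair)
  have adj': "T D \<bullet> v = (\<alpha> *\<^sub>R fst D, \<beta> *\<^sub>R snd D) \<bullet> (E v, f v)" for D v by (simp add: adj)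
  have "T D \<bullet> T D \<le> flex_norm \<alpha> \<beta> (fst D) (snd D) * norm (T D v* M)"
    unfolding adj' flex_norm_Pair EM[symmetric] by (rule norm_cauchy_schwarz)
  also have "\<dots> \<le> flex_norm \<alpha> \<beta> (fst D) (snd D) * (spec_norm M * norm (T D))"
    by (intro mult_left_mono norm_vec_mult_le_spec flex_norm_nonneg)
  finally have "norm (T D) * norm (T D) \<le> (spec_norm M * flex_norm \<alpha> \<beta> (fst D) (snd D)) * norm (T D)"
    by (simp add: power2_norm_eq_inner[symmetric] power2_eq_square mult_ac)
  then show "norm (T D) \<le> spec_norm M * flex_norm \<alpha> \<beta> (fst D) (snd D)"
    using spec_norm_nonneg[of M] flex_norm_nonneg[of \<alpha> \<beta> "fst D" "snd D"] by (cases "T D = 0") auto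
  show "\<exists>D. \<kappa>' * flex_norm \<alpha> \<beta> (fst D) (snd D) < norm (T D)" if "\<kappa>' < spec_norm M"
  proof (cases "\<kappa>' < 0")
    case True
    define D :: "(real^'n^'m) \<times> (real^'m)" where "D = (0, 1)"
    have "flex_norm \<alpha> \<beta> (fst D) (snd D) > 0" using \<beta> by (simp add: D_def flex_norm_Pair)
    then have "\<kappa>' * flex_norm \<alpha> \<beta> (fst D) (snd D) < 0" using True by (simp add: mult_neg_pos)
    then show ?thesis using norm_ge_zero[of "T D"] by (intro exI[of _ D]) linarith
  next
    case False
    have "\<not> (\<forall>v. norm (v v* M) \<le> \<kappa>' * norm v)"
      using that spec_norm_le_adjoint[of M \<kappa>'] by auto
    then obtain v where v: "\<kappa>' * norm v < norm (v v* M)" by (auto simp: not_le)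
    define a where "a = norm (v v* M)"
    have a: "a > 0" using v False by (smt (verit) a_def mult_nonneg_nonneg norm_ge_zero)
    have "v \<noteq> 0" using v by auto
    define D where "D = (E v /\<^sub>R \<alpha>, f v /\<^sub>R \<beta>)"
    have D: "(\<alpha> *\<^sub>R fst D, \<beta> *\<^sub>R snd D) = (E v, f v)" using \<alpha> \<beta> by (simp add: D_def)
    then have flex: "flex_norm \<alpha> \<beta> (fst D) (snd D) = a" by (simp add: flex_norm_Pair EM a_def)
    have "T D \<bullet> v = (norm (E v, f v))\<^sup>2" unfolding adj' D by (rule power2_norm_eq_inner[symmetric])
    then have "a\<^sup>2 \<le> norm (T D) * norm v" using norm_cauchy_schwarz[of "T D" v] by (simp only: EM a_def)
    moreover have "a * (\<kappa>' * norm v) < a\<^sup>2" using a v by (simp add: power2_eq_square a_def)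
    ultimately have "(\<kappa>' * a) * norm v < norm (T D) * norm v" by (simp add: mult_ac)
    then have "\<kappa>' * a < norm (T D)" using \<open>v \<noteq> 0\<close> by simp
    then show ?thesis using flex by metis
  qed
qed

text \<open>
  The choice of \<open>c1\<close> and \<open>c2\<close> matters only through \<open>c1\<^sup>2\<close> and \<open>(c2 - c1)\<^sup>2 - c1\<^sup>2 = - \<beta>\<^sup>2 / \<alpha>\<^sup>2\<close>. The latter makes
  the two terms in the square of the inner product with \<open>t\<close> cancel, one from each block column of the
  second factor. This is why all four sign choices give the same norm.
\<close>

lemma condition_matrix_adjoint_norm:
  fixes H1 :: "real^'m^'k" and K :: "real^'n^'k" and t :: "real^'m" and x :: "real^'n"
  assumes \<alpha>: "\<alpha> > 0" and \<beta>: "\<beta> > 0" and x: "x \<noteq> 0" and t: "t \<noteq> 0"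
    and c1: "c1\<^sup>2 = \<beta>\<^sup>2 / \<alpha>\<^sup>2 + 1 / (norm x)\<^sup>2" and c2: "(c2 - c1)\<^sup>2 = 1 / (norm x)\<^sup>2"
    and M: "M = hcat (- (norm x / \<beta>) *\<^sub>R H1) ((norm t / \<alpha>) *\<^sub>R K)
                 ** vcat (hcat (mat c1 - (c2 / (norm t)\<^sup>2) *\<^sub>R outer t t)
                               ((\<beta> / \<alpha> / (norm t * norm x)) *\<^sub>R outer t x))
                         (hcat 0 (mat 1))"
  shows "(norm (v v* M))\<^sup>2 = (1 / \<alpha>\<^sup>2 + 1 / (\<beta>\<^sup>2 * (norm x)\<^sup>2)) * ((norm x)\<^sup>2 * (norm (v v* H1))\<^sup>2)
     + (norm t)\<^sup>2 / \<alpha>\<^sup>2 * (norm (v v* K))\<^sup>2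
     - 2 / \<alpha>\<^sup>2 * ((v v* H1) \<bullet> t) * ((v v* K) \<bullet> x)"
proof -
  define u w where "u = v v* H1" and "w = v v* K"
  define a where "a = - (norm x / \<beta>) *\<^sub>R u"
  define c where "c = (norm t / \<alpha>) *\<^sub>R w"
  have sc: "v v* (k *\<^sub>R X) = k *\<^sub>R (v v* X)" for v and k and X :: "real^'i^'j"
    by (simp add: vec_eq_iff vector_matrix_mult_def sum_distrib_left mult_ac)
  have mat: "v v* mat k = k *\<^sub>R v" for k and v :: "real^'j"
    by (simp add: vec_eq_iff vector_matrix_mult_def mat_def if_distrib if_distribR sum.delta cong: if_cong)
  have 0: "v v* (0 :: real^'i^'j) = 0" for v by (simp add: vec_eq_iff vector_matrix_mult_def)
  have diffM: "v v* (X - Y) = v v* X - v v* Y" for v and X Y :: "real^'i^'j"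
    by (simp add: vector_matrix_mult_diff_rdistrib)
  define p where "p = c1 *\<^sub>R a + (- (c2 / (norm t)\<^sup>2 * (a \<bullet> t))) *\<^sub>R t"
  define q where "q = c + (\<beta> / \<alpha> / (norm t * norm x) * (a \<bullet> t)) *\<^sub>R x"
  have "v v* M = vcat a c v* vcat (hcat (mat c1 - (c2 / (norm t)\<^sup>2) *\<^sub>R outer t t)
                               ((\<beta> / \<alpha> / (norm t * norm x)) *\<^sub>R outer t x))
                         (hcat 0 (mat 1))"
    unfolding M vector_matrix_mul_assoc[symmetric] vector_mult_hcat sc a_def c_def u_def w_def ..
  also have "\<dots> = vcat p q"
    unfolding vector_mult_parts[of "vcat a c"] parts_vcat vector_mult_hcat
    by (simp add: vec_eq_iff vcat_def p_def q_def sc mat 0 diffM vector_mult_outer split: sum.split)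
  finally have "(norm (v v* M))\<^sup>2 = (norm p)\<^sup>2 + (norm q)\<^sup>2"
    by (simp add: power2_norm_eq_inner inner_vcat)
  also have "(norm p)\<^sup>2 = c1\<^sup>2 * (norm a)\<^sup>2 - 2 * (c2 / (norm t)\<^sup>2 * (a \<bullet> t)) * (c1 * (a \<bullet> t))
       + (c2 / (norm t)\<^sup>2 * (a \<bullet> t))\<^sup>2 * (norm t)\<^sup>2"
    unfolding p_def norm_add_scaleR_sq by (simp add: power_mult_distrib)
  also have "\<dots> = c1\<^sup>2 * (norm a)\<^sup>2 + ((c2 - c1)\<^sup>2 - c1\<^sup>2) * (a \<bullet> t)\<^sup>2 / (norm t)\<^sup>2"
    using t by (simp add: power2_eq_square field_simps)
  also have "(c2 - c1)\<^sup>2 - c1\<^sup>2 = - (\<beta>\<^sup>2 / \<alpha>\<^sup>2)" unfolding c1 c2 by simp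
  also have "(norm q)\<^sup>2 = (norm c)\<^sup>2 + 2 * (\<beta> / \<alpha> / (norm t * norm x) * (a \<bullet> t)) * (c \<bullet> x)
      + (\<beta> / \<alpha> / (norm t * norm x) * (a \<bullet> t))\<^sup>2 * (norm x)\<^sup>2"
    unfolding q_def norm_add_scaleR_sq ..
  also have "(\<beta> / \<alpha> / (norm t * norm x) * (a \<bullet> t))\<^sup>2 * (norm x)\<^sup>2 = \<beta>\<^sup>2 / \<alpha>\<^sup>2 * (a \<bullet> t)\<^sup>2 / (norm t)\<^sup>2"
    using x by (simp add: power_mult_distrib power_divide)
  also have "2 * (\<beta> / \<alpha> / (norm t * norm x) * (a \<bullet> t)) * (c \<bullet> x) = - (2 / \<alpha>\<^sup>2 * (u \<bullet> t) * (w \<bullet> x))"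
    using x t \<beta> by (simp add: a_def c_def power2_eq_square)
  also have "c1\<^sup>2 * (norm a)\<^sup>2 = (1 / \<alpha>\<^sup>2 + 1 / (\<beta>\<^sup>2 * (norm x)\<^sup>2)) * ((norm x)\<^sup>2 * (norm u)\<^sup>2)"
    unfolding c1 a_def using \<beta> x by (simp add: power_mult_distrib power_divide field_simps)
  also have "(norm c)\<^sup>2 = (norm t)\<^sup>2 / \<alpha>\<^sup>2 * (norm w)\<^sup>2"
    by (simp add: c_def power_mult_distrib power_divide)
  finally show ?thesis by (simp add: u_def w_def)
qed

text \<open>
  Both blocks of the adjoint of \<open>T\<close> have explicit norms: the \<open>\<Delta>L\<close> block is a difference of two matrices of
  rank one, whose mixed term is the mixed term of \<open>|M\<^sup>T v|\<^sup>2\<close>. In the bound, that term is at most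
  \<open>(\<beta> / \<alpha>) (a\<^sup>2 + c\<^sup>2)\<close> with \<open>a = |x| |H\<^sub>1\<^sup>T v| / \<beta>\<close> and \<open>c = |t| |K\<^sup>T v| / \<alpha>\<close>.
\<close>

lemma derivative_flex_norm:
  fixes H1 :: "real^'m^'k" and K :: "real^'n^'k" and t :: "real^'m" and x :: "real^'n"
  assumes \<alpha>: "\<alpha> > 0" and \<beta>: "\<beta> > 0" and x: "x \<noteq> 0" and t: "t \<noteq> 0"
    and c1: "c1\<^sup>2 = \<beta>\<^sup>2 / \<alpha>\<^sup>2 + 1 / (norm x)\<^sup>2" and c2: "(c2 - c1)\<^sup>2 = 1 / (norm x)\<^sup>2"
    and M: "M = hcat (- (norm x / \<beta>) *\<^sub>R H1) ((norm t / \<alpha>) *\<^sub>R K)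
                 ** vcat (hcat (mat c1 - (c2 / (norm t)\<^sup>2) *\<^sub>R outer t t)
                               ((\<beta> / \<alpha> / (norm t * norm x)) *\<^sub>R outer t x))
                         (hcat 0 (mat 1))"
    and T: "\<And>D. T D = H1 *v (fst D *v x - snd D) - K *v (t v* fst D)"
  shows "norm (T D) \<le> spec_norm M * flex_norm \<alpha> \<beta> (fst D) (snd D)"
    and "\<kappa>' < spec_norm M \<Longrightarrow> \<exists>D. \<kappa>' * flex_norm \<alpha> \<beta> (fst D) (snd D) < norm (T D)"
    and "spec_norm M \<le> (norm x / \<beta> * spec_norm H1 + norm t / \<alpha> * spec_norm K)
      * sqrt (max 1 (\<beta>\<^sup>2 / \<alpha>\<^sup>2 + 1 / (norm x)\<^sup>2) + \<beta> / \<alpha>)"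
proof -
  define E where "E v = (1 / \<alpha>) *\<^sub>R (outer (v v* H1) x - outer t (v v* K))" for v
  define f where "f v = - (1 / \<beta>) *\<^sub>R (v v* H1)" for v
  note Mv = condition_matrix_adjoint_norm[OF \<alpha> \<beta> x t c1 c2 M]
  have adj: "T D \<bullet> v = \<alpha> * (fst D \<bullet> E v) + \<beta> * (snd D \<bullet> f v)" for D v
  proof -
    have "T D \<bullet> v = (v v* H1) \<bullet> (fst D *v x - snd D) - (v v* K) \<bullet> (t v* fst D)"
      by (simp add: T inner_diff_right dot_lmul_matrix inner_commute[of _ v] matrix_vector_mult_diff_distrib)
    also have "(v v* K) \<bullet> (t v* fst D) = t \<bullet> (fst D *v (v v* K))"
      by (metis dot_lmul_matrix inner_commute)
    also have "(v v* H1) \<bullet> (fst D *v x - snd D) - \<dots> = \<alpha> * (fst D \<bullet> E v) + \<beta> * (snd D \<bullet> f v)"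
      using \<alpha> \<beta> by (simp add: E_def f_def inner_diff_right inner_outer inner_commute[of "snd D"])
    finally show ?thesis .
  qed
  have norms: "(norm (E v))\<^sup>2 + (norm (f v))\<^sup>2 = (norm (v v* M))\<^sup>2" for v
  proof -
    define u w where "u = v v* H1" and "w = v v* K"
    have "(norm (outer u x - outer t w))\<^sup>2 = (norm u)\<^sup>2 * (norm x)\<^sup>2 + (norm t)\<^sup>2 * (norm w)\<^sup>2 - 2 * ((u \<bullet> t) * (w \<bullet> x))"
    proof -
      have "outer u x \<bullet> outer t w = (u \<bullet> t) * (w \<bullet> x)"
        by (simp add: inner_outer outer_mult inner_commute)
      moreover have "outer u x + (-1) *\<^sub>R outer t w = outer u x - outer t w" by simp
      ultimately show ?thesis
        using norm_add_scaleR_sq[of "outer u x" "-1" "outer t w"]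
        by (simp add: norm_outer power_mult_distrib)
    qed
    then have E2: "(norm (E v))\<^sup>2 = ((norm u)\<^sup>2 * (norm x)\<^sup>2 + (norm t)\<^sup>2 * (norm w)\<^sup>2 - 2 * ((u \<bullet> t) * (w \<bullet> x))) / \<alpha>\<^sup>2"
      by (simp add: E_def u_def w_def power_mult_distrib power_divide)
    have f2: "(norm (f v))\<^sup>2 = (norm u)\<^sup>2 / \<beta>\<^sup>2"
      by (simp add: f_def u_def power_mult_distrib power_divide)
    have "(1 / \<alpha>\<^sup>2 + 1 / (\<beta>\<^sup>2 * (norm x)\<^sup>2)) * ((norm x)\<^sup>2 * (norm u)\<^sup>2)
        = (norm u)\<^sup>2 * (norm x)\<^sup>2 / \<alpha>\<^sup>2 + (norm u)\<^sup>2 / \<beta>\<^sup>2"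
      using x by (simp add: distrib_right)
    then show ?thesis unfolding Mv u_def[symmetric] w_def[symmetric] E2 f2
      by (simp add: add_divide_distrib diff_divide_distrib)
  qed
  note flex_operator_norm[of \<alpha> \<beta> T E f M, OF \<alpha> \<beta> adj norms]
  then show "norm (T D) \<le> spec_norm M * flex_norm \<alpha> \<beta> (fst D) (snd D)"
    and "\<kappa>' < spec_norm M \<Longrightarrow> \<exists>D. \<kappa>' * flex_norm \<alpha> \<beta> (fst D) (snd D) < norm (T D)" by blast+
  define m where "m = max 1 (\<beta>\<^sup>2 / \<alpha>\<^sup>2 + 1 / (norm x)\<^sup>2) + \<beta> / \<alpha>"
  have m0: "m \<ge> 0" using \<alpha> \<beta> by (simp add: m_def)
  show "spec_norm M \<le> (norm x / \<beta> * spec_norm H1 + norm t / \<alpha> * spec_norm K) * sqrt m"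
  proof (rule spec_norm_le_adjoint)
    fix v
    define a where "a = norm x / \<beta> * norm (v v* H1)"
    define c where "c = norm t / \<alpha> * norm (v v* K)"
    define s where "s = - (((v v* H1) \<bullet> t) * ((v v* K) \<bullet> x))"
    have ac: "a \<ge> 0" "c \<ge> 0" using \<alpha> \<beta> by (simp_all add: a_def c_def)
    have "s \<le> (norm (v v* H1) * norm t) * (norm (v v* K) * norm x)"
    proof -
      have "s \<le> \<bar>(v v* H1) \<bullet> t\<bar> * \<bar>(v v* K) \<bullet> x\<bar>" unfolding s_def abs_mult[symmetric] by simp
      also have "\<dots> \<le> (norm (v v* H1) * norm t) * (norm (v v* K) * norm x)"
        by (intro mult_mono Cauchy_Schwarz_ineq2) auto
      finally show ?thesis .
    qed
    also have "\<dots> = \<alpha> * \<beta> * (a * c)" using \<alpha> \<beta> by (simp add: a_def c_def)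
    finally have s: "s \<le> \<alpha> * \<beta> * (a * c)" .
    have "2 / \<alpha>\<^sup>2 * s \<le> 2 / \<alpha>\<^sup>2 * (\<alpha> * \<beta> * (a * c))" using s \<alpha> by (intro mult_left_mono) auto
    also have "\<dots> = \<beta> / \<alpha> * (2 * a * c)" using \<alpha> by (simp add: power2_eq_square)
    also have "\<dots> \<le> \<beta> / \<alpha> * (a\<^sup>2 + c\<^sup>2)" using \<alpha> \<beta> sum_squares_bound[of a c] by (intro mult_left_mono) auto
    finally have cross: "2 / \<alpha>\<^sup>2 * s \<le> \<beta> / \<alpha> * (a\<^sup>2 + c\<^sup>2)" .
    have "(norm (v v* M))\<^sup>2 = (\<beta>\<^sup>2 / \<alpha>\<^sup>2 + 1 / (norm x)\<^sup>2) * a\<^sup>2 + 1 * c\<^sup>2 + 2 / \<alpha>\<^sup>2 * s"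
      unfolding Mv a_def c_def s_def using \<alpha> \<beta> x
      by (simp add: power_mult_distrib power_divide field_simps)
    also have "\<dots> \<le> max 1 (\<beta>\<^sup>2 / \<alpha>\<^sup>2 + 1 / (norm x)\<^sup>2) * a\<^sup>2 + max 1 (\<beta>\<^sup>2 / \<alpha>\<^sup>2 + 1 / (norm x)\<^sup>2) * c\<^sup>2
        + \<beta> / \<alpha> * (a\<^sup>2 + c\<^sup>2)"
      by (intro add_mono mult_right_mono cross) auto
    also have "\<dots> = m * (a\<^sup>2 + c\<^sup>2)" by (simp add: m_def algebra_simps)
    also have "\<dots> \<le> m * (a + c)\<^sup>2"
      using ac m0 by (intro mult_left_mono) (simp_all add: power2_sum)
    finally have "(norm (v v* M))\<^sup>2 \<le> ((a + c) * sqrt m)\<^sup>2" using m0 by (simp add: power_mult_distrib mult_ac)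
    then have "norm (v v* M) \<le> (a + c) * sqrt m" by (rule power2_le_imp_le) (use ac m0 in simp)
    also have "\<dots> \<le> (norm x / \<beta> * (spec_norm H1 * norm v) + norm t / \<alpha> * (spec_norm K * norm v)) * sqrt m"
      unfolding a_def c_def using \<alpha> \<beta> m0
      by (intro mult_right_mono add_mono mult_left_mono norm_vec_mult_le_spec) auto
    finally show "norm (v v* M) \<le> (norm x / \<beta> * spec_norm H1 + norm t / \<alpha> * spec_norm K) * sqrt m * norm v"
      by (simp add: algebra_simps)
  qed
qed

section \<open>Pseudoinverse and null space of the constraint matrix\<close>

lemma matrix_inv_mult:
  fixes A :: "real^'n^'n"
  assumes "inj ((*v) A)"
  shows "A ** matrix_inv A = mat 1" "matrix_inv A ** A = mat 1"
proof -
  have "invertible A"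
    using assms by (simp add: invertible_left_inverse matrix_left_invertible_injective)
  then have "\<exists>B. A ** B = mat 1 \<and> B ** A = mat 1" by (simp add: invertible_def)
  from someI_ex[OF this] show "A ** matrix_inv A = mat 1" "matrix_inv A ** A = mat 1"
    by (simp_all add: matrix_inv_def)
qed

lemma is_pinv_unique:
  fixes M :: "real^'n^'m"
  assumes X: "is_pinv M X" and Y: "is_pinv M Y"
  shows "X = Y"
proof -
  have MX: "M ** X = M ** Y"
  proof -
    have "M ** X = (M ** Y) ** (M ** X)" using Y by (simp add: is_pinv_def matrix_mul_assoc)
    then have "transpose (M ** X) = transpose (M ** X) ** transpose (M ** Y)"
      by (metis matrix_transpose_mul)
    also have "\<dots> = (M ** X) ** (M ** Y)" using X Y by (simp add: is_pinv_def)
    also have "\<dots> = M ** Y" using X by (simp add: is_pinv_def matrix_mul_assoc)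
    finally show ?thesis using X by (simp add: is_pinv_def)
  qed
  have XM: "X ** M = Y ** M"
  proof -
    have "X ** M = (X ** M) ** (Y ** M)" using Y by (simp add: is_pinv_def matrix_mul_assoc[symmetric])
    then have "transpose (X ** M) = transpose (Y ** M) ** transpose (X ** M)"
      by (metis matrix_transpose_mul)
    also have "\<dots> = (Y ** M) ** (X ** M)" using X Y by (simp add: is_pinv_def)
    also have "\<dots> = Y ** M" using X by (simp add: is_pinv_def matrix_mul_assoc[symmetric])
    finally show ?thesis using X by (simp add: is_pinv_def)
  qed
  have "X = X ** (M ** X)" using X by (simp add: is_pinv_def matrix_mul_assoc)
  also have "\<dots> = (X ** M) ** Y" by (simp add: MX matrix_mul_assoc)
  also have "\<dots> = Y" using Y by (simp add: XM is_pinv_def)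
  finally show ?thesis .
qed

text \<open>
  For injective \<open>M\<^sup>T\<close> the matrix \<open>M\<^sup>T (M M\<^sup>T)\<^sup>-\<^sup>1\<close> satisfies the Penrose equations, and all three claims can be read
  off from it.
\<close>

lemma pinv_full_row_rank:
  fixes M :: "real^'n^'m"
  assumes inj: "inj (\<lambda>m. m v* M)"
  shows "M ** pinv M = mat 1" and "\<exists>m. pinv M *v w = m v* M" and "M *v z = 0 \<Longrightarrow> z v* pinv M = 0"
proof -
  define G where "G = M ** transpose M"
  define X where "X = transpose M ** matrix_inv G"
  have "inj ((*v) G)"
  proof (subst linear_injective_0[OF matrix_vector_mul_linear], intro allI impI)
    fix m assume "G *v m = 0"
    moreover have "m \<bullet> (G *v m) = (norm (m v* M))\<^sup>2"
      by (simp add: G_def matrix_vector_mul_assoc[symmetric] dot_lmul_matrix[symmetric] power2_norm_eq_inner)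
    ultimately show "m = 0" using inj by (simp add: linear_injective_0[OF linear_vec_mult])
  qed
  note G = matrix_inv_mult[OF this]
  have G_sym: "transpose G = G" by (simp add: G_def matrix_transpose_mul)
  have "transpose (matrix_inv G) ** G = mat 1"
    using arg_cong[OF G(1), where f = transpose] by (simp add: matrix_transpose_mul G_sym)
  then have "transpose (matrix_inv G) = matrix_inv G"
    by (metis G(1) matrix_mul_assoc matrix_mul_lid matrix_mul_rid)
  then have XM_sym: "transpose (X ** M) = X ** M" by (simp add: X_def matrix_transpose_mul matrix_mul_assoc)
  have MX: "M ** X = mat 1" using G(1) by (simp add: X_def matrix_mul_assoc G_def)
  have X: "is_pinv M X"
    unfolding is_pinv_def using MX XM_sym by (simp add: matrix_mul_assoc[symmetric])
  have pinv: "pinv M = X"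
    unfolding pinv_def using X by (rule the_equality) (rule is_pinv_unique[OF _ X])
  show "M ** pinv M = mat 1" by (simp add: pinv MX)
  show "\<exists>m. pinv M *v w = m v* M"
    unfolding pinv X_def matrix_vector_mul_assoc[symmetric] transpose_matrix_vector by blast
  show "z v* pinv M = 0" if "M *v z = 0"
  proof -
    have "z v* transpose M = 0" using that by simp
    then have "(z v* transpose M) v* matrix_inv G = 0" by (simp add: vec_eq_iff vector_matrix_mult_def)
    then show ?thesis by (simp only: pinv X_def vector_matrix_mul_assoc)
  qed
qed

text \<open>
  The columns of \<open>Q\<^sub>2\<close> are an orthonormal basis of the null space of \<open>C\<close>: since \<open>C\<^sup>T = Q\<^sub>1 R\<^sub>1\<close> with \<open>R\<^sub>1\<close> invertible,
  a vector annihilated by \<open>C\<close> is orthogonal to the columns of \<open>Q\<^sub>1\<close>.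
\<close>

lemma full_QR_null_space:
  fixes C :: "real^'n^'p::{finite,linorder}" and Q2 :: "real^'r^'n"
  assumes QR: "is_full_QR (transpose C) Q1 Q2 R1" and inj: "inj (\<lambda>m. m v* C)"
  shows "(m v* C) v* Q2 = 0" and "C *v (Q2 *v y) = 0" and "C *v u = 0 \<Longrightarrow> Q2 *v (u v* Q2) = u"
    and "(Q2 *v y) v* Q2 = y" and "norm (Q2 *v y) = norm y"
proof -
  define Q where "Q = hcat Q1 Q2"
  have QtQ: "transpose Q ** Q = mat 1" and QQt: "Q ** transpose Q = mat 1"
    and C: "transpose C = Q ** vcat R1 (0 :: real^'p::{finite,linorder}^'r)"
    using QR by (auto simp: is_full_QR_def Q_def)
  have orth: "(Q1 *v a + Q2 *v b) v* Q1 = a" "(Q1 *v a + Q2 *v b) v* Q2 = b" for a b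
  proof -
    have "(Q *v vcat a b) v* Q = vcat a b"
      using QtQ by (metis matrix_vector_mul_assoc matrix_vector_mul_lid transpose_matrix_vector)
    then have "vcat ((Q1 *v a + Q2 *v b) v* Q1) ((Q1 *v a + Q2 *v b) v* Q2) = vcat a b"
      by (simp add: Q_def hcat_mult vector_mult_hcat)
    then show "(Q1 *v a + Q2 *v b) v* Q1 = a" "(Q1 *v a + Q2 *v b) v* Q2 = b"
      by (metis parts_vcat)+
  qed
  have expand: "Q1 *v (u v* Q1) + Q2 *v (u v* Q2) = u" for u
  proof -
    have "Q *v (u v* Q) = u"
      using QQt by (metis matrix_vector_mul_assoc matrix_vector_mul_lid transpose_matrix_vector)
    then show ?thesis by (simp add: Q_def hcat_mult vector_mult_hcat)
  qed
  have mC: "m v* C = Q1 *v (R1 *v m)" for m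
  proof -
    have "m v* C = Q *v (vcat R1 (0 :: real^'p::{finite,linorder}^'r) *v m)"
      by (metis C matrix_vector_mul_assoc transpose_matrix_vector)
    then show ?thesis by (simp add: Q_def hcat_mult vcat_mult)
  qed
  show mCQ2: "(m v* C) v* Q2 = 0" for m using orth(2)[of "R1 *v m" 0] by (simp add: mC)
  show "C *v (Q2 *v y) = 0"
  proof -
    have "m \<bullet> (C *v (Q2 *v y)) = 0" for m
      by (metis dot_lmul_matrix mCQ2 inner_zero_left)
    then show ?thesis by (metis inner_eq_zero_iff)
  qed
  show id: "(Q2 *v y) v* Q2 = y" for y using orth(2)[of 0 y] by simp
  show "norm (Q2 *v y) = norm y"
    by (simp add: norm_eq_sqrt_inner dot_lmul_matrix[symmetric] id)
  show "Q2 *v (u v* Q2) = u" if "C *v u = 0"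
  proof -
    have "inj ((*v) R1)"
      using inj unfolding linear_injective_0[OF linear_vec_mult] linear_injective_0[OF matrix_vector_mul_linear]
      by (auto simp: mC)
    then obtain m where m: "R1 *v m = u v* Q1"
      using linear_injective_imp_surjective[of "(*v) R1"] by (metis matrix_vector_mul_linear surjD)
    have "(u v* Q1) \<bullet> (u v* Q1) = u \<bullet> (m v* C)" by (simp add: mC m dot_lmul_matrix)
    also have "\<dots> = m \<bullet> (C *v u)" by (simp add: dot_lmul_matrix[symmetric] inner_commute)
    also have "\<dots> = 0" using that by simp
    finally show ?thesis using expand[of u] by simp
  qed
qed

text \<open>
  The map \<open>(y, \<eta>) \<mapsto> (\<zeta> \<eta> x\<^sub>C + Q\<^sub>2 y, \<zeta> \<eta>)\<close> is an isometry onto the feasible space of the homogeneous problem,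
  because \<open>x\<^sub>C\<close> is orthogonal to the range of \<open>Q\<^sub>2\<close> and \<open>\<zeta>\<close> normalises \<open>(x\<^sub>C, 1)\<close>. In these coordinates the
  homogeneous residual is \<open>N (y, \<eta>)\<close>, and the horizontal vectors are those with \<open>\<eta> = 0\<close>, on which \<open>N\<close> acts
  as \<open>A Q\<^sub>2\<close>.
\<close>

lemma reduced_tls_matrix:
  fixes A :: "real^'n^'q" and b :: "real^'q" and Q2 :: "real^'r^'n"
    and C :: "real^'n^'p::{finite,linorder}" and d :: "real^'p::{finite,linorder}"
  assumes QR: "is_full_QR (transpose C) Q1 Q2 R1" and inj: "inj (\<lambda>m. m v* C)"
    and \<zeta>: "\<zeta> = 1 / sqrt (1 + (norm xC)\<^sup>2)" and xC: "xC = pinv C *v d" and rC: "rC = A *v xC - b"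
    and N: "N = append_col (A ** Q2) (\<zeta> *\<^sub>R rC)"
  shows "(u, \<tau>) \<in> hom_feasible (vcat C A) (vcat d b) \<Longrightarrow>
      \<exists>v. norm v = norm (u, \<tau>) \<and> norm (N *v v) = norm (hom_res (vcat C A) (vcat d b) (u, \<tau>)) \<and>
        (\<tau> = 0 \<longrightarrow> norm (A ** Q2 *v top_part v) = norm (N *v v) \<and> norm (top_part v) = norm v)"
    and "\<exists>z \<in> hom_feasible (vcat C A) (vcat d b).
      norm z = norm v \<and> norm (hom_res (vcat C A) (vcat d b) z) = norm (N *v v)"
proof -
  note Q = full_QR_null_space[OF QR inj]
  have \<zeta>0: "\<zeta> > 0" and \<zeta>2: "\<zeta>\<^sup>2 * (1 + (norm xC)\<^sup>2) = 1"
    using add_pos_nonneg[of 1 "(norm xC)\<^sup>2"] by (simp_all add: \<zeta> power_divide)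
  have CxC: "C *v xC = d"
    by (simp add: xC matrix_vector_mul_assoc pinv_full_row_rank(1)[OF inj])
  obtain m where m: "xC = m v* C" using pinv_full_row_rank(2)[OF inj, of d] xC by blast
  have xCQ2: "xC \<bullet> (Q2 *v y) = 0" for y
    using Q(1)[of m] by (simp add: m dot_lmul_matrix[symmetric])
  define emb where "emb v = ((\<zeta> * v $ Inr 1) *\<^sub>R xC + Q2 *v top_part v, \<zeta> * v $ Inr 1)" for v :: "real^('r + 1)"
  have norm_v: "(norm v)\<^sup>2 = (norm (top_part v))\<^sup>2 + (v $ Inr 1)\<^sup>2" for v :: "real^('r + 1)"
    by (simp add: norm_parts_sq[of v] norm_real bottom_part_def)
  have norm_emb: "norm (emb v) = norm v" for v
  proof (rule power2_eq_imp_eq)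
    define k where "k = v $ Inr 1"
    have "(norm ((\<zeta> * k) *\<^sub>R xC + Q2 *v top_part v))\<^sup>2 = (\<zeta> * k)\<^sup>2 * (norm xC)\<^sup>2 + (norm (top_part v))\<^sup>2"
      using norm_add_scaleR_sq[of "(\<zeta> * k) *\<^sub>R xC" 1 "Q2 *v top_part v"]
      by (simp add: xCQ2 Q(5) power_mult_distrib)
    then have "(norm (emb v))\<^sup>2 = \<zeta>\<^sup>2 * (1 + (norm xC)\<^sup>2) * k\<^sup>2 + (norm (top_part v))\<^sup>2"
      by (simp add: emb_def norm_Pair k_def[symmetric] power_mult_distrib algebra_simps)
    then show "(norm (emb v))\<^sup>2 = (norm v)\<^sup>2" by (simp add: \<zeta>2 norm_v k_def)
  qed simp_all
  have res_emb: "hom_res (vcat C A) (vcat d b) (emb v) = vcat 0 (N *v v)" for v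
  proof -
    have "C *v fst (emb v) = (\<zeta> * v $ Inr 1) *\<^sub>R d"
      by (simp add: emb_def matrix_vector_right_distrib matrix_vector_mult_scaleR CxC Q(2))
    moreover have "A *v fst (emb v) - (\<zeta> * v $ Inr 1) *\<^sub>R b = N *v v"
      by (simp add: emb_def N append_col_mult rC matrix_vector_right_distrib matrix_vector_mult_scaleR
          matrix_vector_mul_assoc scaleR_diff_right mult.commute)
    ultimately show ?thesis
      unfolding hom_res_def vcat_mult
      by (simp add: vec_eq_iff vcat_def emb_def split: sum.split)
  qed
  have norm_vcat0: "norm (vcat 0 u) = norm u" for u :: "real^'q"
    by (simp add: norm_eq_sqrt_inner inner_vcat)
  have feas_emb: "emb v \<in> hom_feasible (vcat C A) (vcat d b)" for v
    by (simp add: hom_feasible_def res_emb)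
  show "\<exists>z \<in> hom_feasible (vcat C A) (vcat d b).
      norm z = norm v \<and> norm (hom_res (vcat C A) (vcat d b) z) = norm (N *v v)"
    using feas_emb[of v] norm_emb[of v] by (intro bexI[of _ "emb v"]) (simp_all add: res_emb norm_vcat0)
  show "\<exists>v. norm v = norm (u, \<tau>) \<and> norm (N *v v) = norm (hom_res (vcat C A) (vcat d b) (u, \<tau>)) \<and>
        (\<tau> = 0 \<longrightarrow> norm (A ** Q2 *v top_part v) = norm (N *v v) \<and> norm (top_part v) = norm v)"
    if z: "(u, \<tau>) \<in> hom_feasible (vcat C A) (vcat d b)"
  proof -
    define v where "v = vcat ((u - \<tau> *\<^sub>R xC) v* Q2) (\<chi> i::1. \<tau> / \<zeta>)"
    have "C *v (u - \<tau> *\<^sub>R xC) = 0"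
      using z by (simp add: hom_feasible_def hom_res_def vcat_mult parts_simps matrix_vector_mult_diff_distrib
          matrix_vector_mult_scaleR CxC)
    from Q(3)[OF this] have emb: "emb v = (u, \<tau>)" using \<zeta>0 by (simp add: emb_def v_def)
    show ?thesis
    proof (intro exI[of _ v] conjI impI)
      show "norm v = norm (u, \<tau>)" using norm_emb[of v] emb by simp
      show "norm (N *v v) = norm (hom_res (vcat C A) (vcat d b) (u, \<tau>))"
        using res_emb[of v] by (simp add: emb norm_vcat0)
      assume "\<tau> = 0"
      then have last: "v $ Inr 1 = 0" by (simp add: v_def)
      then show "norm (A ** Q2 *v top_part v) = norm (N *v v)" by (simp add: N append_col_mult)
      have "(norm (top_part v))\<^sup>2 = (norm v)\<^sup>2" using last norm_v[of v] by simp
      then show "norm (top_part v) = norm v" by simp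
    qed
  qed
qed

section \<open>The normwise condition number\<close>

theorem theorem4p2:
  fixes A :: "real^'n^'q" and b :: "real^'q"
    and C :: "real^'n^'p::{finite,linorder}" and d :: "real^'p::{finite,linorder}"
    and L :: "real^'n^('p::{finite,linorder} + 'q::finite)"
    and h :: "real^('p::{finite,linorder} + 'q::finite)"
    and Q1 :: "real^'p::{finite,linorder}^'n"
    and Q2 :: "real^'r^'n" and R1 :: "real^'p::{finite,linorder}^'p::{finite,linorder}"
    and x x\<^sub>C :: "real^'n" and r r\<^sub>C :: "real^'q"
    and t :: "real^('p::{finite,linorder} + 'q::finite)"
    and S11 :: "real^'r^'r" and K :: "real^'n^'n" and CA :: "real^'p::{finite,linorder}^'n"
    and H1 :: "real^('p::{finite,linorder} + 'q::finite)^'n"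
    and \<alpha> \<beta> \<zeta> \<rho> \<sigma> c1 c2 \<kappa>U :: real
  assumes q_gt_n: "CARD('q) > CARD('n)"
    and card_r: "CARD('r) = CARD('n) - CARD('p)"
    and L: "L = vcat C A" and h: "h = vcat d b"
    and rank_C: "rank C = CARD('p)"
    and rank_L: "rank L = CARD('n)"
    and QR: "is_full_QR (transpose C) Q1 Q2 R1"
    and x\<^sub>C: "x\<^sub>C = pinv C *v d"
    and r\<^sub>C: "r\<^sub>C = A *v x\<^sub>C - b"
    and \<zeta>: "\<zeta> = 1 / sqrt (1 + (norm x\<^sub>C)\<^sup>2)"
    and \<sigma>: "\<sigma> = sing_val (CARD('n) - CARD('p) + 1) (append_col (A ** Q2) (\<zeta> *\<^sub>R r\<^sub>C))"
    and generic: "sing_val (CARD('n) - CARD('p)) (A ** Q2) > \<sigma>"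
    and x: "x = tlse_map L h"
    and \<alpha>: "\<alpha> > 0" and \<beta>: "\<beta> > 0"
    and S11: "S11 = transpose Q2 ** transpose A ** A ** Q2 - mat (\<sigma>\<^sup>2)"
    and K: "K = Q2 ** matrix_inv S11 ** transpose Q2"
    and CA: "CA = (mat 1 - K ** transpose A ** A) ** pinv C"
    and \<rho>: "\<rho> = sqrt (1 + (norm x)\<^sup>2)"
    and r: "r = A *v x - b"
    and t: "t = vcat (- (r v* (append_col A b ** pinv (append_col C d)))) r"
    and H1: "H1 = (2 / \<rho>\<^sup>2) *\<^sub>R outer (K *v x) t - hcat CA (K ** transpose A)"
    and x_nz: "x \<noteq> 0" and t_nz: "t \<noteq> 0"
    and c1: "c1 = sqrt (\<beta>\<^sup>2 / \<alpha>\<^sup>2 + 1 / (norm x)\<^sup>2) \<or> c1 = - sqrt (\<beta>\<^sup>2 / \<alpha>\<^sup>2 + 1 / (norm x)\<^sup>2)"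
    and c2: "c2 = c1 + 1 / norm x \<or> c2 = c1 - 1 / norm x"
    and \<kappa>U: "\<kappa>U = (norm x / \<beta> * spec_norm H1 + norm t / \<alpha> * spec_norm K)
                * (flex_norm \<alpha> \<beta> L h / norm x)
                * sqrt (max 1 (\<beta>\<^sup>2 / \<alpha>\<^sup>2 + 1 / (norm x)\<^sup>2) + \<beta> / \<alpha>)"
  shows "(cond_quotient_sup tlse_map \<alpha> \<beta> L h \<longlongrightarrow> normwise_cond tlse_map \<alpha> \<beta> L h) (at_right 0)
    \<and> normwise_cond tlse_map \<alpha> \<beta> L h =
        ereal (spec_norm
                (hcat (- (norm x / \<beta>) *\<^sub>R H1) ((norm t / \<alpha>) *\<^sub>R K)
                 ** vcat (hcat (mat c1 - (c2 / (norm t)\<^sup>2) *\<^sub>R outer t t)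
                               ((\<beta> / \<alpha> / (norm t * norm x)) *\<^sub>R outer t x))
                         (hcat 0 (mat 1)))
               * (flex_norm \<alpha> \<beta> L h / norm x))
    \<and> normwise_cond tlse_map \<alpha> \<beta> L h \<le> ereal \<kappa>U
    \<and> \<kappa>U \<le> (norm x / \<beta> * (spec_norm CA + spec_norm (K ** transpose A))
             + (2 / \<beta> + 1 / \<alpha>) * spec_norm K * norm t)
            * (flex_norm \<alpha> \<beta> L h / norm x)
            * sqrt (max 1 (\<beta>\<^sup>2 / \<alpha>\<^sup>2 + 1 / (norm x)\<^sup>2) + \<beta> / \<alpha>)"
proof -
  have top: "top_part L = C" "top_part h = d" and bot: "bottom_part L = A" "bottom_part h = b"
    by (simp_all add: L h)
  have "CARD('p) + CARD('r) = CARD('n)" using card_r zero_less_card_finite[where 'a = 'r] by linarith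
  then have pn: "CARD('p) \<le> CARD('n)" by linarith
  have "inj ((*v) (transpose C))"
    using rank_C by (simp add: full_rank_injective[symmetric] rank_transpose del: transpose_matrix_vector)
  moreover have "(*v) (transpose C) = (\<lambda>m. m v* C)" by (rule ext) simp
  ultimately have inj: "inj (\<lambda>m. m v* C)" by simp
  obtain c where c: "c > 0" "\<And>m. c * norm m \<le> norm (m v* top_part L)"
    using linear_inj_bounded_below_pos[OF linear_vec_mult inj] by (auto simp: top)
  note Q = full_QR_null_space[OF QR inj]
  define N where "N = append_col (A ** Q2) (\<zeta> *\<^sub>R r\<^sub>C)"
  note reduced = reduced_tls_matrix[OF QR inj \<zeta> x\<^sub>C r\<^sub>C N_def, folded L h]
  have \<sigma>N: "\<sigma> = sing_val CARD('r + 1) N" by (simp add: \<sigma> N_def card_r)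
  have low: "\<sigma>\<^sup>2 * (norm z)\<^sup>2 \<le> (norm (hom_res L h z))\<^sup>2" if z: "z \<in> hom_feasible L h" for z
  proof -
    obtain v where "norm v = norm z" "norm (N *v v) = norm (hom_res L h z)"
      using reduced(1)[of "fst z" "snd z"] z by auto
    then show ?thesis using smallest_sing_val(2)[of N v] by (simp add: \<sigma>N)
  qed
  obtain v0 where v0: "v0 \<noteq> 0" "(norm (N *v v0))\<^sup>2 = \<sigma>\<^sup>2 * (norm v0)\<^sup>2"
    using smallest_sing_val(3)[of N] by (auto simp: \<sigma>N)
  obtain z0 where z0: "z0 \<in> hom_feasible L h" "norm z0 = norm v0" "norm (hom_res L h z0) = norm (N *v v0)"
    using reduced(2)[of v0] by auto
  have z0_ne: "z0 \<noteq> 0" using z0(2) v0(1) by auto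
  have z0_min: "hom_minimiser L h (\<sigma>\<^sup>2) z0"
    using z0 v0(2) low by (simp add: hom_minimiser_def)
  \<comment> \<open>a horizontal minimiser would give \<open>\<sigma>\<^sub>n\<^sub>-\<^sub>p(A Q\<^sub>2)\<^sup>2 \<le> \<sigma>\<^sup>2\<close>, against the genericity condition\<close>
  have no_horizontal: "w = 0" if w: "hom_minimiser L h s w" "snd w = 0" for s w
  proof (rule ccontr)
    assume "w \<noteq> 0"
    have "s * (norm z0)\<^sup>2 \<le> \<sigma>\<^sup>2 * (norm z0)\<^sup>2"
      using w(1) z0_min by (auto simp: hom_minimiser_def)
    then have s: "s \<le> \<sigma>\<^sup>2" using z0_ne by simp
    obtain u where u: "w = (u, 0)" using w(2) by (metis prod.collapse)
    have "(u, 0) \<in> hom_feasible L h" using w(1) by (simp add: u hom_minimiser_def)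
    from reduced(1)[OF this] obtain v where "norm v = norm w"
      "norm (N *v v) = norm (hom_res L h w)" "norm (A ** Q2 *v top_part v) = norm (N *v v)"
      "norm (top_part v) = norm v"
      unfolding u by blast
    then have v: "norm (A ** Q2 *v top_part v) = norm (hom_res L h w)" "norm (top_part v) = norm w"
      by simp_all
    define \<sigma>' where "\<sigma>' = sing_val CARD('r) (A ** Q2)"
    have "\<sigma>'\<^sup>2 * (norm w)\<^sup>2 \<le> s * (norm w)\<^sup>2"
      using smallest_sing_val(2)[of "A ** Q2" "top_part v"] w(1) v by (simp add: \<sigma>'_def hom_minimiser_def)
    then have "\<sigma>'\<^sup>2 \<le> \<sigma>\<^sup>2" using s \<open>w \<noteq> 0\<close> by simp
    moreover have "0 \<le> \<sigma>" using smallest_sing_val(1)[of N] by (simp add: \<sigma>N)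
    moreover have "\<sigma> < \<sigma>'" using generic by (simp add: \<sigma>'_def card_r)
    ultimately show False by (simp add: power2_le_iff_abs_le)
  qed
  have x_min: "hom_minimiser L h (\<sigma>\<^sup>2) (x, 1)"
    unfolding x using z0_ne no_horizontal by (intro tlse_map_eq_hom_minimiser(3)[OF z0_min]) auto
  then have Cx: "C *v x = d" by (simp add: hom_minimiser_def affine_feasible_iff top)
  obtain t0 where t0: "t0 v* L = \<sigma>\<^sup>2 *\<^sub>R x" "t0 \<bullet> h = - \<sigma>\<^sup>2" "bottom_part t0 = r"
    using tlse_multiplier[OF x_min] by (auto simp: parts_simps parts_mult bot r)
  \<comment> \<open>\<open>r\<^sup>T [A b] = \<sigma>\<^sup>2 (x, -1)\<^sup>T - m\<^sup>T [C d]\<close>, and multiplying by the pseudoinverse of \<open>[C d]\<close> isolates \<open>- m\<^sup>T\<close>\<close>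
  have "t0 = t"
  proof -
    define m where "m = top_part t0"
    define Ct where "Ct = append_col C d"
    define z where "z = vcat x (\<chi> i::1. (- 1 :: real))"
    have injCt: "inj (\<lambda>m. m v* Ct)"
    proof (subst linear_injective_0[OF linear_vec_mult], intro allI impI)
      fix m assume "m v* Ct = 0"
      then have "top_part (m v* Ct) = 0" by (simp add: parts_simps)
      then have "m v* C = 0" by (simp add: Ct_def vector_mult_append_col)
      then show "m = 0" using inj by (simp add: linear_injective_0[OF linear_vec_mult])
    qed
    have "Ct *v z = 0" by (simp add: Ct_def z_def append_col_mult Cx)
    then have z: "z v* pinv Ct = 0" by (rule pinv_full_row_rank(3)[OF injCt])
    have "m v* C + r v* A = \<sigma>\<^sup>2 *\<^sub>R x"
      using t0(1) vector_mult_parts[of t0 L] by (simp only: top bot t0(3) m_def)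
    then have rA: "r v* A = \<sigma>\<^sup>2 *\<^sub>R x - m v* C" by (simp add: eq_diff_eq add.commute)
    have "m \<bullet> d + r \<bullet> b = - \<sigma>\<^sup>2"
      using t0(2) inner_parts[of t0 h] by (simp only: top bot t0(3) m_def)
    then have rb: "r \<bullet> b = - \<sigma>\<^sup>2 - m \<bullet> d" by simp
    have "r v* append_col A b = \<sigma>\<^sup>2 *\<^sub>R z - m v* Ct"
      unfolding Ct_def vector_mult_append_col rA rb z_def
      by (simp add: vec_eq_iff vcat_def split: sum.split)
    then have "r v* (append_col A b ** pinv Ct) = \<sigma>\<^sup>2 *\<^sub>R (z v* pinv Ct) - m v* (Ct ** pinv Ct)"
      by (simp add: vector_matrix_mul_assoc[symmetric] vector_matrix_mult_diff_distrib
          linear_scale[OF linear_vec_mult])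
    then have "r v* (append_col A b ** pinv Ct) = - m"
      by (simp add: z pinv_full_row_rank(1)[OF injCt])
    then show "t0 = t" using vcat_parts[of t0] t0(3) by (simp add: t Ct_def m_def)
  qed
  with t0 have base: "is_tlse_multiplier L h x (\<sigma>\<^sup>2) t"
    by (simp add: is_tlse_multiplier_def parts_simps parts_mult top bot Cx r)
  have S11_mult: "S11 *v y = ((A *v (Q2 *v y)) v* A) v* Q2 - \<sigma>\<^sup>2 *\<^sub>R y" for y
  proof -
    have "mat k *v y = k *\<^sub>R y" for k
      by (simp add: vec_eq_iff matrix_vector_mult_def mat_def if_distrib if_distribR sum.delta' cong: if_cong)
    then show ?thesis
      by (simp add: S11 matrix_vector_mult_diff_rdistrib matrix_vector_mul_assoc[symmetric])
  qed
  \<comment> \<open>a null vector \<open>y\<close> would make \<open>(Q\<^sub>2 y, 0)\<close> a horizontal minimiser\<close>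
  have "inj ((*v) S11)"
  proof (subst linear_injective_0[OF matrix_vector_mul_linear], intro allI impI)
    fix y assume y: "S11 *v y = 0"
    define k where "k = A *v (Q2 *v y)"
    have "((k v* A) v* Q2) \<bullet> y = (norm k)\<^sup>2"
      by (simp only: dot_lmul_matrix k_def power2_norm_eq_inner)
    moreover have "(S11 *v y) \<bullet> y = ((k v* A) v* Q2) \<bullet> y - \<sigma>\<^sup>2 * (norm y)\<^sup>2"
      by (simp only: S11_mult k_def inner_diff_left inner_scaleR_left power2_norm_eq_inner)
    ultimately have k: "(norm k)\<^sup>2 = \<sigma>\<^sup>2 * (norm y)\<^sup>2" using y by simp
    have feas: "(Q2 *v y, 0) \<in> hom_feasible L h"
      by (simp add: hom_feasible_def hom_res_def parts_mult top Q(2))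
    have "(norm (hom_res L h (Q2 *v y, 0)))\<^sup>2 = \<sigma>\<^sup>2 * (norm (Q2 *v y, 0 :: real))\<^sup>2"
      using norm_hom_res_feasible[OF feas] by (simp add: bot k_def[symmetric] k Q(5))
    with feas low have "hom_minimiser L h (\<sigma>\<^sup>2) (Q2 *v y, 0)" by (simp add: hom_minimiser_def)
    from no_horizontal[OF this] have "norm (Q2 *v y) = 0" by (simp add: zero_prod_def)
    then show "y = 0" using Q(5)[of y] by simp
  qed
  note S11_inv = matrix_inv_mult[OF this]
  have K_mult: "K *v v = Q2 *v (matrix_inv S11 *v (v v* Q2))" for v
    by (simp add: K matrix_vector_mul_assoc[symmetric])
  have K_null: "K *v (m v* C) = 0" for m by (simp add: K_mult Q(1))
  \<comment> \<open>split \<open>v\<close> into \<open>p\<close> in the range of \<open>C\<^sup>T\<close> and a vector of the null space of \<open>C\<close>, on which \<open>K\<close> inverts \<open>A\<^sup>T A - \<sigma>\<^sup>2\<close>\<close>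
  have resolvent: "v = K *v ((A *v v) v* A - \<sigma>\<^sup>2 *\<^sub>R v) + CA *v (C *v v)" for v
  proof -
    define g where "g u = (A *v u) v* A - \<sigma>\<^sup>2 *\<^sub>R u" for u
    define p where "p = pinv C *v (C *v v)"
    define y where "y = (v - p) v* Q2"
    have "C *v p = C *v v"
      by (simp add: p_def matrix_vector_mul_assoc matrix_mul_assoc pinv_full_row_rank(1)[OF inj])
    then have y: "Q2 *v y = v - p" unfolding y_def by (intro Q(3)) (simp add: matrix_vector_mult_diff_distrib)
    have "matrix_inv S11 *v (g (Q2 *v y) v* Q2) = y"
    proof -
      have "g (Q2 *v y) v* Q2 = S11 *v y"
        by (simp add: S11_mult g_def vector_matrix_mult_diff_distrib linear_scale[OF linear_vec_mult] Q(4))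
      then show ?thesis by (simp add: matrix_vector_mul_assoc S11_inv(2))
    qed
    then have "K *v g (v - p) = v - p" by (simp add: K_mult y[symmetric])
    moreover have "g v = g (v - p) + g p"
      by (simp add: g_def matrix_vector_mult_diff_distrib vector_matrix_mult_diff_distrib scaleR_diff_right)
    moreover have "K *v p = 0" using pinv_full_row_rank(2)[OF inj, of "C *v v"] K_null by (auto simp: p_def)
    then have "K *v g p = K *v ((A *v p) v* A)"
      by (simp add: g_def matrix_vector_mult_diff_distrib matrix_vector_mult_scaleR)
    moreover have "CA *v (C *v v) = p - K *v ((A *v p) v* A)"
      by (simp add: CA p_def matrix_vector_mult_diff_rdistrib matrix_vector_mul_assoc[symmetric])
    ultimately have "v = K *v g v + CA *v (C *v v)" by (simp add: matrix_vector_right_distrib)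
    then show ?thesis by (simp only: g_def)
  qed
  have \<rho>2: "\<rho>\<^sup>2 = 1 + (norm x)\<^sup>2" by (simp add: \<rho>)
  define T where "T D = H1 *v (fst D *v x - snd D) - K *v (t v* fst D)"
    for D :: "(real^'n^('p + 'q)) \<times> (real^('p + 'q))"
  have der: "((\<lambda>D. tlse_map (fst D) (snd D)) has_derivative T) (at (L, h))"
    unfolding T_def
    by (rule tlse_map_has_derivative[OF pn c _ x base])
      (use no_horizontal in blast, simp_all only: top bot K_null resolvent[symmetric] H1 \<rho>2)
  define M where "M = hcat (- (norm x / \<beta>) *\<^sub>R H1) ((norm t / \<alpha>) *\<^sub>R K)
                 ** vcat (hcat (mat c1 - (c2 / (norm t)\<^sup>2) *\<^sub>R outer t t)
                               ((\<beta> / \<alpha> / (norm t * norm x)) *\<^sub>R outer t x))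
                         (hcat 0 (mat 1))"
  have c1': "c1\<^sup>2 = \<beta>\<^sup>2 / \<alpha>\<^sup>2 + 1 / (norm x)\<^sup>2" using c1 by auto
  have c2': "(c2 - c1)\<^sup>2 = 1 / (norm x)\<^sup>2" using c2 by (auto simp: power_divide)
  note op = derivative_flex_norm[OF \<alpha> \<beta> x_nz t_nz c1' c2' M_def T_def]
  have "L \<noteq> 0" using rank_L by auto
  then have flex: "flex_norm \<alpha> \<beta> L h > 0" using \<alpha> by (simp add: flex_norm_Pair zero_prod_def)
  have lim: "(cond_quotient_sup tlse_map \<alpha> \<beta> L h \<longlongrightarrow> ereal (spec_norm M * (flex_norm \<alpha> \<beta> L h / norm x))) (at_right 0)"
    unfolding x by (rule cond_quotient_sup_tendsto[OF der \<alpha> \<beta> _ flex op(1,2)]) (use x_nz x in auto)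
  then have cond: "normwise_cond tlse_map \<alpha> \<beta> L h = ereal (spec_norm M * (flex_norm \<alpha> \<beta> L h / norm x))"
    unfolding normwise_cond_def by (intro tendsto_Lim) auto
  define F where "F = flex_norm \<alpha> \<beta> L h / norm x"
  define m where "m = sqrt (max 1 (\<beta>\<^sup>2 / \<alpha>\<^sup>2 + 1 / (norm x)\<^sup>2) + \<beta> / \<alpha>)"
  have F0: "F \<ge> 0" and m0: "m \<ge> 0" using flex \<alpha> \<beta> by (simp_all add: F_def m_def)
  have "spec_norm M * F \<le> \<kappa>U"
    using mult_right_mono[OF op(3) F0] by (simp add: \<kappa>U F_def m_def mult_ac)
  moreover have "\<kappa>U \<le> (norm x / \<beta> * (spec_norm CA + spec_norm (K ** transpose A))
             + (2 / \<beta> + 1 / \<alpha>) * spec_norm K * norm t) * F * m"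
  proof -
    \<comment> \<open>this absorbs the factor \<open>2 \<rho>\<^sup>-\<^sup>2 |x|\<^sup>2\<close> of the first term of \<open>H1\<close>\<close>
    have x\<rho>: "norm x * (2 / \<rho>\<^sup>2 * norm x) \<le> 2"
    proof -
      have "1 + (norm x)\<^sup>2 > 0" by (simp add: add_pos_nonneg)
      then show ?thesis unfolding \<rho>2 by (simp add: power2_eq_square divide_le_eq)
    qed
    have "spec_norm H1 \<le> 2 / \<rho>\<^sup>2 * (spec_norm K * norm x * norm t) + (spec_norm CA + spec_norm (K ** transpose A))"
    proof -
      have "spec_norm ((2 / \<rho>\<^sup>2) *\<^sub>R outer (K *v x) t) \<le> 2 / \<rho>\<^sup>2 * spec_norm (outer (K *v x) t)"
        using spec_norm_scaleR_le[of "2 / \<rho>\<^sup>2" "outer (K *v x) t"] by simp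
      also have "\<dots> \<le> 2 / \<rho>\<^sup>2 * (norm (K *v x) * norm t)"
        by (intro mult_left_mono spec_norm_outer_le) simp
      also have "\<dots> \<le> 2 / \<rho>\<^sup>2 * (spec_norm K * norm x * norm t)"
        by (intro mult_left_mono mult_right_mono norm_mult_le_spec) simp_all
      finally show ?thesis unfolding H1
        using spec_norm_diff_le[of "(2 / \<rho>\<^sup>2) *\<^sub>R outer (K *v x) t" "hcat CA (K ** transpose A)"]
          spec_norm_hcat_le[of CA "K ** transpose A"] by linarith
    qed
    then have "norm x / \<beta> * spec_norm H1 \<le> norm x / \<beta> *
        (2 / \<rho>\<^sup>2 * (spec_norm K * norm x * norm t) + (spec_norm CA + spec_norm (K ** transpose A)))"
      using \<beta> by (intro mult_left_mono) auto
    also have "\<dots> = (norm x * (2 / \<rho>\<^sup>2 * norm x)) * (spec_norm K * norm t / \<beta>)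
        + norm x / \<beta> * (spec_norm CA + spec_norm (K ** transpose A))"
      by (simp add: distrib_left mult_ac)
    also have "\<dots> \<le> 2 * (spec_norm K * norm t / \<beta>)
        + norm x / \<beta> * (spec_norm CA + spec_norm (K ** transpose A))"
      using \<beta> spec_norm_nonneg[of K] by (intro add_right_mono mult_right_mono x\<rho>) simp
    finally have "norm x / \<beta> * spec_norm H1 + norm t / \<alpha> * spec_norm K
        \<le> norm x / \<beta> * (spec_norm CA + spec_norm (K ** transpose A)) + (2 / \<beta> + 1 / \<alpha>) * spec_norm K * norm t"
      by (simp add: distrib_right distrib_left mult_ac)
    then show ?thesis unfolding \<kappa>U F_def[symmetric] m_def[symmetric]
      using F0 m0 by (intro mult_right_mono)
  qed
  ultimately show ?thesis
    using lim unfolding cond M_def[symmetric] F_def[symmetric] m_def[symmetric] by simp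
qed

end
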